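(* Let $T>0$, $H\in(1/2,1)$, $\beta\in(0,1]$. Assume that $V_0\in C_b^1(\mathbb{R}^n,\mathbb{R}^n)$ and $V_1,\dots,V_d\in C_b^2(\mathbb{R}^n,\mathbb{R}^n)$. For $y>0$ let $X^H(y)$ be the solution of $$X_{t}^{H}(y)=x_{0}+\sqrt{y}\sum_{j=1}^{d}\int_{0}^{t}V_{j}(X_{s}^{H}(y))\,dB_{H}^{j}(s)+\int_{0}^{t}V_{0}(X_{s}^{H}(y))\,ds,\quad t\in[0,T].$$ Then the process $\{X^H_t(Y_\beta),\,t\in[0,T]\}$ obtained by substituting $y=Y_\beta$ satisfies the stochastic differential equation $$X_{t}^{H}=x_{0}+\sum_{j=1}^{d}\int_{0}^{t}V_{j}(X_{s}^{H})\,d\big(\sqrt{Y_{\beta}}B_{H}^{j}\big)(s)+\int_{0}^{t}V_{0}(X_{s}^{H})\,ds,\quad t\in[0,T].$$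
   Context: $n,d\ge 1$ are integers and $x_0\in\mathbb{R}^n$ is fixed. On a probability space $(\Omega,\mathcal{F},\mathbb{P})$, $\bm{B}_H=(B_H^1,\dots,B_H^d)$ is a standard $d$-dimensional fractional Brownian motion with Hurst parameter $H$ (independent components, each centered Gaussian with covariance $\frac12(t^{2H}+s^{2H}-|t-s|^{2H})$), and $Y_\beta$ is a non-negative random variable independent of $\bm{B}_H$ whose law has density $M_\beta$ (the $M$-Wright density), characterized by the Laplace transform $\mathbb{E}(e^{-sY_\beta})=\int_0^\infty e^{-s\tau}M_\beta(\tau)\,d\tau=E_\beta(-s)$, $s\ge0$, with $E_\beta(x)=\sum_{k=0}^\infty x^k/\Gamma(\beta k+1)$ the Mittag-Leffler function (for $\beta=1$, $Y_1=1$ a.s.). $C_b^k(\mathbb{R}^n,\mathbb{R}^m)$ is the space of bounded, $k$ times continuously (Fréchet) differentiable functions with bounded derivatives up to order $k$. Integrals with respect to $B_H^j$ and $\sqrt{Y_\beta}B_H^j$ are pathwise Riemann–Stieltjes (Young) integrals. $X^H(y)$ denotes the unique solution, with $(1-\lambda)$-Hölder continuous paths for $1-H<\lambda<\frac12$. For each $t$, one uses a modification of $y\mapsto X_t^H(y)$ that is continuous in $y$. $X^H_t(Y_\beta)$ denotes the random variable $\omega\mapsto X^H_t(y)(\omega)|_{y=Y_\beta(\omega)}$. *)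

theory Defs
  imports "HOL-Probability.Probability"
begin

definition mittag_leffler :: "real \<Rightarrow> real \<Rightarrow> real" where
  "mittag_leffler \<beta> x = (\<Sum>k. x ^ k / Gamma (\<beta> * real k + 1))"

(* The M-Wright density is determined (up to null sets) by its Laplace transform. *)
definition M_Wright_density :: "real \<Rightarrow> (real \<Rightarrow> real) \<Rightarrow> bool" where
  "M_Wright_density \<beta> m \<longleftrightarrow>
     m \<in> borel_measurable borel \<and> (\<forall>\<tau>. 0 \<le> m \<tau>) \<and>
     (\<forall>s\<ge>0. set_integrable lborel {0..} (\<lambda>\<tau>. exp (- s * \<tau>) * m \<tau>) \<and>
            (LINT \<tau>:{0..}|lborel. exp (- s * \<tau>) * m \<tau>) = mittag_leffler \<beta> (- s))"

(* For \<beta> = 1 the law degenerates to the Dirac measure at 1 and has no density. *)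
definition M_Wright_rv :: "'w measure \<Rightarrow> real \<Rightarrow> ('w \<Rightarrow> real) \<Rightarrow> bool" where
  "M_Wright_rv M \<beta> Y \<longleftrightarrow>
     Y \<in> borel_measurable M \<and> (AE \<omega> in M. 0 \<le> Y \<omega>) \<and>
     (if \<beta> = 1 then AE \<omega> in M. Y \<omega> = 1
      else \<exists>m. M_Wright_density \<beta> m \<and> distributed M lborel Y (\<lambda>\<tau>. ennreal (m \<tau>)))"

(* Constants count as (degenerate) Gaussian variables. *)
definition gaussian_rv :: "'w measure \<Rightarrow> ('w \<Rightarrow> real) \<Rightarrow> bool" where
  "gaussian_rv M Z \<longleftrightarrow>
     Z \<in> borel_measurable M \<and>
     ((\<exists>\<mu> \<sigma>. 0 < \<sigma> \<and> distributed M lborel Z (\<lambda>x. ennreal (normal_density \<mu> \<sigma> x))) \<or>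
      (\<exists>\<mu>. AE \<omega> in M. Z \<omega> = \<mu>))"

definition gaussian_process :: "'w measure \<Rightarrow> real set \<Rightarrow> (real \<Rightarrow> 'w \<Rightarrow> real) \<Rightarrow> bool" where
  "gaussian_process M I b \<longleftrightarrow>
     (\<forall>J c. finite J \<and> J \<subseteq> I \<longrightarrow> gaussian_rv M (\<lambda>\<omega>. \<Sum>t\<in>J. c t * b t \<omega>))"

definition fBm :: "'w measure \<Rightarrow> real \<Rightarrow> (real \<Rightarrow> 'w \<Rightarrow> real) \<Rightarrow> bool" where
  "fBm M H b \<longleftrightarrow>
     gaussian_process M {0..} b \<and>
     (\<forall>t\<ge>0. integral\<^sup>L M (b t) = 0) \<and>
     (\<forall>s\<ge>0. \<forall>t\<ge>0. integral\<^sup>L M (\<lambda>\<omega>. b s \<omega> * b t \<omega>)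
        = (t powr (2 * H) + s powr (2 * H) - \<bar>t - s\<bar> powr (2 * H)) / 2) \<and>
     (AE \<omega> in M. continuous_on {0..} (\<lambda>t. b t \<omega>))"

definition standard_fBm :: "'w measure \<Rightarrow> real \<Rightarrow> (real \<Rightarrow> 'w \<Rightarrow> real ^ 'd) \<Rightarrow> bool" where
  "standard_fBm M H B \<longleftrightarrow>
     (\<forall>j. fBm M H (\<lambda>t \<omega>. B t \<omega> $ j)) \<and>
     prob_space.indep_vars M (\<lambda>j. Pi\<^sub>M {0..} (\<lambda>_. borel))
       (\<lambda>j \<omega>. \<lambda>t\<in>{0::real..}. B t \<omega> $ j) UNIV"

(* prob_space.indep_var requires both variables to take values in the same type. *)
definition indep_rv ::
  "'w measure \<Rightarrow> 'a measure \<Rightarrow> ('w \<Rightarrow> 'a) \<Rightarrow> 'b measure \<Rightarrow> ('w \<Rightarrow> 'b) \<Rightarrow> bool" where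
  "indep_rv M N\<^sub>1 X\<^sub>1 N\<^sub>2 X\<^sub>2 \<longleftrightarrow>
     X\<^sub>1 \<in> measurable M N\<^sub>1 \<and> X\<^sub>2 \<in> measurable M N\<^sub>2 \<and>
     prob_space.indep_set M {X\<^sub>1 -` A \<inter> space M | A. A \<in> sets N\<^sub>1}
                            {X\<^sub>2 -` A \<inter> space M | A. A \<in> sets N\<^sub>2}"

definition C_b1 :: "('a::real_normed_vector \<Rightarrow> 'b::real_normed_vector) \<Rightarrow> bool" where
  "C_b1 f \<longleftrightarrow>
     bounded (range f) \<and>
     (\<exists>f' :: 'a \<Rightarrow> 'a \<Rightarrow>\<^sub>L 'b.
        (\<forall>x. (f has_derivative blinfun_apply (f' x)) (at x)) \<and>
        continuous_on UNIV f' \<and> bounded (range f'))"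

definition C_b2 :: "('a::real_normed_vector \<Rightarrow> 'b::real_normed_vector) \<Rightarrow> bool" where
  "C_b2 f \<longleftrightarrow>
     bounded (range f) \<and>
     (\<exists>f' :: 'a \<Rightarrow> 'a \<Rightarrow>\<^sub>L 'b.
        (\<forall>x. (f has_derivative blinfun_apply (f' x)) (at x)) \<and> C_b1 f')"

definition holder_on :: "real \<Rightarrow> real set \<Rightarrow> (real \<Rightarrow> 'a::real_normed_vector) \<Rightarrow> bool" where
  "holder_on \<alpha> S x \<longleftrightarrow> (\<exists>C. \<forall>s\<in>S. \<forall>t\<in>S. norm (x s - x t) \<le> C * \<bar>s - t\<bar> powr \<alpha>)"

(* Limit of Riemann-Stieltjes sums as the mesh tends to 0, for a \<le> b; only u 0, ..., u n and
   \<xi> 0, ..., \<xi> (n - 1) are relevant. *)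
definition has_RS_integral ::
  "(real \<Rightarrow> 'a::real_normed_vector) \<Rightarrow> (real \<Rightarrow> real) \<Rightarrow> real \<Rightarrow> real \<Rightarrow> 'a \<Rightarrow> bool" where
  "has_RS_integral f g a b I \<longleftrightarrow>
     (\<forall>\<epsilon>>0. \<exists>\<delta>>0. \<forall>n (u :: nat \<Rightarrow> real) \<xi>.
        u 0 = a \<and> u n = b \<and>
        (\<forall>i<n. u i \<le> \<xi> i \<and> \<xi> i \<le> u (Suc i) \<and> u (Suc i) - u i < \<delta>) \<longrightarrow>
        norm ((\<Sum>i<n. (g (u (Suc i)) - g (u i)) *\<^sub>R f (\<xi> i)) - I) < \<epsilon>)"

(* A path x satisfies, for all t in [0,T],
     x(t) = x0 + c * (sum over j of the integral of V j (x) dz^j over [0,t])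
               + (integral of V0 (x) ds over [0,t]),
   which includes the existence of all the Stieltjes integrals. *)
definition path_equation ::
  "real \<Rightarrow> real ^ 'n \<Rightarrow> real \<Rightarrow> (real ^ 'n \<Rightarrow> real ^ 'n) \<Rightarrow> ('d \<Rightarrow> real ^ 'n \<Rightarrow> real ^ 'n) \<Rightarrow>
   (real \<Rightarrow> real ^ 'd) \<Rightarrow> (real \<Rightarrow> real ^ 'n) \<Rightarrow> bool" where
  "path_equation T x0 c V0 V z x \<longleftrightarrow>
     (\<forall>t\<in>{0..T}. \<exists>J.
        (\<forall>j. has_RS_integral (\<lambda>s. V j (x s)) (\<lambda>s. z s $ j) 0 t (J j)) \<and>
        x t = x0 + c *\<^sub>R (\<Sum>j\<in>UNIV. J j) + integral {0..t} (\<lambda>s. V0 (x s)))"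

(* Random variables are understood modulo null sets, hence the completion. The Hoelder
   requirement is part of the notion of solution and makes the drift integral exist. *)
definition solves_SDE ::
  "'w measure \<Rightarrow> real \<Rightarrow> real \<Rightarrow> real ^ 'n \<Rightarrow> real \<Rightarrow> (real ^ 'n \<Rightarrow> real ^ 'n) \<Rightarrow>
   ('d \<Rightarrow> real ^ 'n \<Rightarrow> real ^ 'n) \<Rightarrow> (real \<Rightarrow> 'w \<Rightarrow> real ^ 'd) \<Rightarrow> (real \<Rightarrow> 'w \<Rightarrow> real ^ 'n) \<Rightarrow> bool" where
  "solves_SDE M T lam x0 c V0 V Z X \<longleftrightarrow>
     (\<forall>t\<in>{0..T}. X t \<in> borel_measurable (completion M)) \<and>
     (AE \<omega> in M. holder_on (1 - lam) {0..T} (\<lambda>t. X t \<omega>) \<and>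
                 path_equation T x0 c V0 V (\<lambda>t. Z t \<omega>) (\<lambda>t. X t \<omega>))"

end

theory Submission
  imports Defs
begin

text \<open>
  For each fixed \<open>y > 0\<close> the equation for \<open>X y\<close> holds outside a null set that depends on \<open>y\<close>, while
  \<open>Y\<close> takes uncountably many values, so \<open>y = Y \<omega>\<close> cannot simply be inserted. The idea is that
  countably many parameters suffice. Outside a single null set the equation holds at all positive
  dyadic rationals \<open>y\<close>, and on a path where \<open>y \<mapsto> X y t \<omega>\<close> is continuous, the set of all \<open>y > 0\<close> at which
  the pathwise equation holds is closed in the positive half-line. Hence it holds for every
  \<open>y > 0\<close>, in particular for \<open>y = Y \<omega>\<close>, which is almost surely positive (\<open>M_Wright_rv_pos\<close>).

  The closedness is deterministic (\<open>path_equation_limit\<close>) and rests on Young integration with the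
  exponent \<open>\<gamma> = 1 - lam\<close>. As \<open>lam < 1/2\<close>, we have \<open>2 * \<gamma> > 1\<close>, so Riemann-Stieltjes sums of
  \<open>\<gamma>\<close>-Hoelder functions against \<open>\<gamma>\<close>-Hoelder functions converge at a rate that depends only on the two
  Hoelder constants (\<open>young_estimate\<close>, \<open>RS_sum_error\<close>). The same inequality, applied to the equation
  itself, bounds the Hoelder constant of every solution in terms of the data alone
  (\<open>path_equation_apriori_bound\<close>). Solutions along a convergent sequence of parameters are therefore
  uniformly Hoelder, their integrals are approximated by finite sums uniformly along the sequence,
  and pointwise convergence of the solutions is enough to pass to the limit in all integrals.

  This needs paths of \<open>B\<close> that are Hoelder with exponent \<open>1 - lam\<close>. As \<open>1 - lam < H\<close>, it follows from
  the Gaussian moments of the increments by the Kolmogorov-Chentsov argument (\<open>fBm_holder_paths\<close>).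

  Finally \<open>\<omega> \<mapsto> X (Y \<omega>) t \<omega>\<close> is measurable for the completed measure, because it is almost surely the
  limit of what one obtains by rounding \<open>Y\<close> to dyadic rationals
  (\<open>borel_measurable_random_parameter\<close>).
\<close>

section \<open>Hoelder continuity with an explicit constant\<close>

text \<open>
  The limit arguments below need bounds that are uniform along a sequence of functions, so the
  constant, which \<open>holder_on\<close> hides behind an existential quantifier, is kept as a parameter.
\<close>

definition holder_bound :: "real \<Rightarrow> real \<Rightarrow> real set \<Rightarrow> (real \<Rightarrow> 'a::real_normed_vector) \<Rightarrow> bool" where
  "holder_bound C \<gamma> S x \<longleftrightarrow> (\<forall>s\<in>S. \<forall>t\<in>S. norm (x s - x t) \<le> C * \<bar>s - t\<bar> powr \<gamma>)"

lemma holder_boundD: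
  "holder_bound C \<gamma> S x \<Longrightarrow> s \<in> S \<Longrightarrow> t \<in> S \<Longrightarrow> norm (x s - x t) \<le> C * \<bar>s - t\<bar> powr \<gamma>"
  by (simp add: holder_bound_def)

lemma holder_bound_subset: "holder_bound C \<gamma> S x \<Longrightarrow> S' \<subseteq> S \<Longrightarrow> holder_bound C \<gamma> S' x"
  by (auto simp: holder_bound_def)

lemma holder_on_iff_holder_bound: "holder_on \<gamma> S x \<longleftrightarrow> (\<exists>C\<ge>0. holder_bound C \<gamma> S x)"
proof
  assume "holder_on \<gamma> S x"
  then obtain C where C: "norm (x s - x t) \<le> C * \<bar>s - t\<bar> powr \<gamma>" if "s \<in> S" "t \<in> S" for s t
    unfolding holder_on_def by blast
  have "norm (x s - x t) \<le> max C 0 * \<bar>s - t\<bar> powr \<gamma>" if "s \<in> S" "t \<in> S" for s t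
    using C[OF that] mult_right_mono[of C "max C 0" "\<bar>s - t\<bar> powr \<gamma>"] by simp
  then show "\<exists>C\<ge>0. holder_bound C \<gamma> S x"
    unfolding holder_bound_def by (intro exI[of _ "max C 0"]) auto
qed (auto simp: holder_on_def holder_bound_def)

lemma holder_boundI_ordered:
  assumes "\<And>s t. s \<in> S \<Longrightarrow> t \<in> S \<Longrightarrow> s < t \<Longrightarrow> norm (x t - x s) \<le> C * (t - s) powr \<gamma>"
  shows "holder_bound C \<gamma> S x"
  unfolding holder_bound_def
proof (intro ballI)
  fix s t assume "s \<in> S" "t \<in> S"
  then show "norm (x s - x t) \<le> C * \<bar>s - t\<bar> powr \<gamma>"
    using assms[of s t] assms[of t s]
    by (cases s t rule: linorder_cases) (auto simp: norm_minus_commute abs_if)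
qed

lemma holder_bound_continuous_on:
  assumes "holder_bound C \<gamma> S x" "0 < \<gamma>"
  shows "continuous_on S x"
proof -
  have "(x \<longlongrightarrow> x s) (at s within S)" if s: "s \<in> S" for s
  proof -
    have lim: "((\<lambda>t. C * \<bar>t - s\<bar> powr \<gamma>) \<longlongrightarrow> C * 0) (at s within S)"
    proof (rule tendsto_mult[OF tendsto_const])
      have "((\<lambda>t. \<bar>t - s\<bar>) \<longlongrightarrow> \<bar>s - s\<bar>) (at s within S)"
        by (intro tendsto_intros)
      from tendsto_powr'[OF this tendsto_const[of \<gamma>]] show "((\<lambda>t. \<bar>t - s\<bar> powr \<gamma>) \<longlongrightarrow> 0) (at s within S)"
        using \<open>0 < \<gamma>\<close> by simp
    qed
    have ev: "\<forall>\<^sub>F t in at s within S. norm (x t - x s) \<le> C * \<bar>t - s\<bar> powr \<gamma>"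
      using assms(1) s by (auto simp: eventually_at_filter holder_bound_def)
    have "((\<lambda>t. x t - x s) \<longlongrightarrow> 0) (at s within S)"
      by (rule Lim_null_comparison[OF ev]) (use lim in simp)
    then show ?thesis
      by (simp add: LIM_zero_iff)
  qed
  then show ?thesis
    by (simp add: continuous_on_def)
qed

section \<open>The Young-Loeve inequality\<close>

definition dyadic_point :: "real \<Rightarrow> real \<Rightarrow> nat \<Rightarrow> nat \<Rightarrow> real" where
  "dyadic_point a b n i = a + (b - a) * (real i / 2 ^ n)"

definition dyadic_sum ::
  "(real \<Rightarrow> 'a::real_normed_vector) \<Rightarrow> (real \<Rightarrow> real) \<Rightarrow> real \<Rightarrow> real \<Rightarrow> nat \<Rightarrow> 'a" where
  "dyadic_sum f g a b n =
     (\<Sum>i<2 ^ n. (g (dyadic_point a b n (Suc i)) - g (dyadic_point a b n i)) *\<^sub>R f (dyadic_point a b n i))"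

text \<open>
  The sum of the geometric series that controls successive dyadic refinements.
\<close>

definition young_const :: "real \<Rightarrow> real" where
  "young_const \<gamma> = 1 / (1 - 2 powr (1 - 2 * \<gamma>))"

lemma young_const_pos: "1 / 2 < \<gamma> \<Longrightarrow> 0 < young_const \<gamma>"
proof -
  assume "1 / 2 < \<gamma>"
  then have "2 powr (1 - 2 * \<gamma>) < 2 powr (0::real)"
    by (intro powr_less_mono) auto
  then show ?thesis
    by (simp add: young_const_def)
qed

lemma dyadic_point_bounds:
  assumes "a \<le> b" "i \<le> 2 ^ n"
  shows "dyadic_point a b n i \<in> {a..b}"
proof -
  have "real i / 2 ^ n \<le> 1"
    using assms(2) of_nat_mono[OF assms(2), where 'a=real] by simp
  then have "(b - a) * (real i / 2 ^ n) \<le> (b - a) * 1"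
    using assms(1) by (intro mult_left_mono) auto
  moreover have "0 \<le> (b - a) * (real i / 2 ^ n)"
    using assms(1) by simp
  ultimately show ?thesis
    by (auto simp: dyadic_point_def)
qed

lemma sum_split_even_odd:
  fixes h :: "nat \<Rightarrow> 'a::comm_monoid_add"
  shows "(\<Sum>i<2 * m. h i) = (\<Sum>i<m. h (2 * i) + h (Suc (2 * i)))"
  by (induction m) (auto simp: add_ac)

lemma sum_lessThan_add:
  fixes h :: "nat \<Rightarrow> 'a::comm_monoid_add"
  shows "(\<Sum>i<m + n. h i) = (\<Sum>i<m. h i) + (\<Sum>i<n. h (m + i))"
  by (induction n) (auto simp: add_ac)

text \<open>
  Inserting the midpoint \<open>m\<close> into a cell \<open>[p, q]\<close> changes its summand by
  \<open>(g q - g m) *\<^sub>R (f m - f p)\<close> only, which is of order \<open>(q - p)\<close> to the power \<open>2 * \<gamma>\<close>. There are \<open>2 ^ n\<close>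
  such cells of length \<open>(b - a) / 2 ^ n\<close>, so for \<open>2 * \<gamma> > 1\<close> the total change decays
  geometrically in \<open>n\<close>.
\<close>

lemma dyadic_sum_refine:
  fixes f :: "real \<Rightarrow> 'a::real_normed_vector"
  assumes "a \<le> b" "0 \<le> F" "0 \<le> K"
    and f: "holder_bound F \<gamma> {a..b} f" and g: "holder_bound K \<gamma> {a..b} g" and "0 < \<gamma>"
  shows "norm (dyadic_sum f g a b (Suc n) - dyadic_sum f g a b n)
           \<le> F * K * (b - a) powr (2 * \<gamma>) * (2 powr (1 - 2 * \<gamma>)) ^ n"
proof -
  define h where "h = (b - a) / 2 ^ Suc n"
  have h0: "0 \<le> h"
    using \<open>a \<le> b\<close> by (simp add: h_def)
  define p where "p = dyadic_point a b n"
  define p' where "p' = dyadic_point a b (Suc n)"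
  have even: "p' (2 * i) = p i" for i
    by (simp add: p_def p'_def dyadic_point_def)
  have even': "p' (Suc (Suc (2 * i))) = p (Suc i)" for i
    using even[of "Suc i"] by simp
  have left: "p' (Suc (2 * i)) - p i = h" and right: "p (Suc i) - p' (Suc (2 * i)) = h" for i
    unfolding p_def p'_def dyadic_point_def h_def
    by (simp_all add: add_divide_distrib distrib_left diff_divide_distrib right_diff_distrib)
  have refined: "dyadic_sum f g a b (Suc n) =
      (\<Sum>i<2 ^ n. (g (p' (Suc (2 * i))) - g (p i)) *\<^sub>R f (p i)
                + (g (p (Suc i)) - g (p' (Suc (2 * i)))) *\<^sub>R f (p' (Suc (2 * i))))"
    unfolding dyadic_sum_def p'_def[symmetric] by (simp add: sum_split_even_odd even even')
  have "dyadic_sum f g a b (Suc n) - dyadic_sum f g a b n =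
      (\<Sum>i<2 ^ n. (g (p (Suc i)) - g (p' (Suc (2 * i)))) *\<^sub>R (f (p' (Suc (2 * i))) - f (p i)))"
    unfolding refined unfolding dyadic_sum_def p_def[symmetric] sum_subtractf[symmetric]
    by (intro sum.cong refl) (simp add: algebra_simps)
  also have "norm \<dots> \<le> (\<Sum>i<(2::nat) ^ n. F * K * h powr (2 * \<gamma>))"
  proof (rule sum_norm_le)
    fix i :: nat assume "i \<in> {..<2 ^ n}"
    then have mem: "p i \<in> {a..b}" "p (Suc i) \<in> {a..b}" "p' (Suc (2 * i)) \<in> {a..b}"
      unfolding p_def p'_def by (auto intro!: dyadic_point_bounds[OF \<open>a \<le> b\<close>, unfolded atLeastAtMost_iff])
    have "\<bar>g (p (Suc i)) - g (p' (Suc (2 * i)))\<bar> \<le> K * h powr \<gamma>"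
      using holder_boundD[OF g mem(2,3)] right[of i] h0 by simp
    moreover have "norm (f (p' (Suc (2 * i))) - f (p i)) \<le> F * h powr \<gamma>"
      using holder_boundD[OF f mem(3,1)] left[of i] h0 by simp
    ultimately have "norm ((g (p (Suc i)) - g (p' (Suc (2 * i)))) *\<^sub>R (f (p' (Suc (2 * i))) - f (p i)))
        \<le> (K * h powr \<gamma>) * (F * h powr \<gamma>)"
      unfolding norm_scaleR using assms(2,3) by (intro mult_mono) auto
    also have "\<dots> = F * K * h powr (2 * \<gamma>)"
      using powr_add[of h \<gamma> \<gamma>] by (simp add: mult_ac)
    finally show "norm ((g (p (Suc i)) - g (p' (Suc (2 * i)))) *\<^sub>R (f (p' (Suc (2 * i))) - f (p i)))
        \<le> F * K * h powr (2 * \<gamma>)" .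
  qed
  also have "\<dots> = F * K * (b - a) powr (2 * \<gamma>) * (2 ^ n * (1 / 2 ^ Suc n) powr (2 * \<gamma>))"
    using powr_mult[of "b - a" "1 / 2 ^ Suc n" "2 * \<gamma>"] \<open>a \<le> b\<close> by (simp add: h_def)
  also have "\<dots> \<le> F * K * (b - a) powr (2 * \<gamma>) * (2 powr (1 - 2 * \<gamma>)) ^ n"
  proof (rule mult_left_mono)
    have "(2::real) ^ n * (1 / 2 ^ Suc n) powr (2 * \<gamma>) = 2 powr real n * 2 powr (- real (Suc n) * (2 * \<gamma>))"
    proof -
      have "(1 / 2 ^ Suc n) = (2::real) powr (- real (Suc n))"
        by (simp add: powr_minus powr_realpow[symmetric] divide_simps del: powr_realpow of_nat_Suc power_Suc)
      then show ?thesis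
        by (simp add: powr_powr powr_realpow)
    qed
    also have "\<dots> = 2 powr (real n - real (Suc n) * (2 * \<gamma>))"
      unfolding powr_add[symmetric] by (simp add: algebra_simps)
    also have "\<dots> \<le> 2 powr (real n * (1 - 2 * \<gamma>))"
      using \<open>0 < \<gamma>\<close> by (intro powr_mono) (auto simp: algebra_simps)
    also have "\<dots> = (2 powr (1 - 2 * \<gamma>)) ^ n"
      using powr_powr[of 2 "1 - 2 * \<gamma>" "real n"] powr_realpow[of "2 powr (1 - 2 * \<gamma>)" n]
      by (simp add: mult.commute)
    finally show "(2::real) ^ n * (1 / 2 ^ Suc n) powr (2 * \<gamma>) \<le> (2 powr (1 - 2 * \<gamma>)) ^ n" .
  qed (use assms in auto)
  finally show ?thesis .
qed

lemma dyadic_sum_bound: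
  fixes f :: "real \<Rightarrow> 'a::real_normed_vector"
  assumes "a \<le> b" "0 \<le> F" "0 \<le> K" "1 / 2 < \<gamma>"
    and f: "holder_bound F \<gamma> {a..b} f" and g: "holder_bound K \<gamma> {a..b} g"
  shows "norm (dyadic_sum f g a b n - (g b - g a) *\<^sub>R f a) \<le> young_const \<gamma> * F * K * (b - a) powr (2 * \<gamma>)"
proof -
  define r :: real where "r = 2 powr (1 - 2 * \<gamma>)"
  have r: "0 \<le> r" "r < 1"
    using powr_less_mono[of "1 - 2 * \<gamma>" 0 "2::real"] \<open>1 / 2 < \<gamma>\<close> by (auto simp: r_def)
  have "dyadic_sum f g a b n - (g b - g a) *\<^sub>R f a = dyadic_sum f g a b n - dyadic_sum f g a b 0"
    by (simp add: dyadic_sum_def dyadic_point_def)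
  also have "\<dots> = (\<Sum>k<n. dyadic_sum f g a b (Suc k) - dyadic_sum f g a b k)"
    by (rule sum_lessThan_telescope[symmetric])
  also have "norm \<dots> \<le> (\<Sum>k<n. F * K * (b - a) powr (2 * \<gamma>) * r ^ k)"
    unfolding r_def by (intro sum_norm_le dyadic_sum_refine) (use assms in auto)
  also have "\<dots> = F * K * (b - a) powr (2 * \<gamma>) * ((1 - r ^ n) / (1 - r))"
    using r by (simp add: sum_distrib_left[symmetric] sum_gp_strict)
  also have "\<dots> \<le> F * K * (b - a) powr (2 * \<gamma>) * (1 / (1 - r))"
    using r assms by (intro mult_left_mono divide_right_mono) auto
  finally show ?thesis
    by (simp add: young_const_def r_def mult_ac)
qed

definition tagged_partition :: "real \<Rightarrow> real \<Rightarrow> real \<Rightarrow> nat \<Rightarrow> (nat \<Rightarrow> real) \<Rightarrow> (nat \<Rightarrow> real) \<Rightarrow> bool" where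
  "tagged_partition a b \<delta> n u \<xi> \<longleftrightarrow>
     u 0 = a \<and> u n = b \<and> (\<forall>i<n. u i \<le> \<xi> i \<and> \<xi> i \<le> u (Suc i) \<and> u (Suc i) - u i < \<delta>)"

definition RS_sum ::
  "(real \<Rightarrow> 'a::real_normed_vector) \<Rightarrow> (real \<Rightarrow> real) \<Rightarrow> nat \<Rightarrow> (nat \<Rightarrow> real) \<Rightarrow> (nat \<Rightarrow> real) \<Rightarrow> 'a" where
  "RS_sum f g n u \<xi> = (\<Sum>i<n. (g (u (Suc i)) - g (u i)) *\<^sub>R f (\<xi> i))"

lemma has_RS_integral_iff:
  "has_RS_integral f g a b I \<longleftrightarrow>
     (\<forall>\<epsilon>>0. \<exists>\<delta>>0. \<forall>n u \<xi>. tagged_partition a b \<delta> n u \<xi> \<longrightarrow> norm (RS_sum f g n u \<xi> - I) < \<epsilon>)"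
  unfolding has_RS_integral_def tagged_partition_def RS_sum_def by (rule refl)

lemma has_RS_integralE:
  assumes "has_RS_integral f g a b I" "0 < \<epsilon>"
  obtains \<delta> where "0 < \<delta>"
    and "\<And>n u \<xi>. tagged_partition a b \<delta> n u \<xi> \<Longrightarrow> norm (RS_sum f g n u \<xi> - I) < \<epsilon>"
  using assms unfolding has_RS_integral_iff by blast

text \<open>
  The partition of \<open>[a, a]\<close> with no cells at all is admissible, and its sum is \<open>0\<close>.
\<close>

lemma has_RS_integral_refl_eq_0:
  fixes f :: "real \<Rightarrow> 'a::real_normed_vector"
  assumes "has_RS_integral f g a a I"
  shows "I = 0"
proof (rule ccontr)
  assume "I \<noteq> 0"
  then have "0 < norm I" by simp
  then obtain \<delta> where "0 < \<delta>"
      and \<delta>: "\<And>n u \<xi>. tagged_partition a a \<delta> n u \<xi> \<Longrightarrow> norm (RS_sum f g n u \<xi> - I) < norm I"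
    using has_RS_integralE[OF assms] by blast
  have "tagged_partition a a \<delta> 0 (\<lambda>_. a) (\<lambda>_. a)"
    by (simp add: tagged_partition_def)
  from \<delta>[OF this] show False
    by (simp add: RS_sum_def)
qed

lemma ex_dyadic_mesh: "0 < \<delta> \<Longrightarrow> \<exists>m. (b - a) / 2 ^ m < (\<delta>::real)"
proof -
  assume "0 < \<delta>"
  have "(\<lambda>m. (b - a) * (1 / 2) ^ m) \<longlonglongrightarrow> (b - a) * 0"
    by (intro tendsto_mult tendsto_const LIMSEQ_realpow_zero) auto
  then have "\<forall>\<^sub>F m in sequentially. (b - a) * (1 / 2) ^ m < \<delta>"
    using \<open>0 < \<delta>\<close> by (intro order_tendstoD(2)) auto
  then show ?thesis
    by (auto simp: eventually_sequentially power_one_over field_simps)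
qed

lemma dyadic_point_Suc_diff: "dyadic_point a b n (Suc i) - dyadic_point a b n i = (b - a) / 2 ^ n"
  by (simp add: dyadic_point_def add_divide_distrib distrib_left)

lemma dyadic_point_0 [simp]: "dyadic_point a b n 0 = a"
  and dyadic_point_last [simp]: "dyadic_point a b n (2 ^ n) = b"
  by (simp_all add: dyadic_point_def)

lemma dyadic_point_mono_Suc: "a \<le> b \<Longrightarrow> dyadic_point a b n i \<le> dyadic_point a b n (Suc i)"
  using dyadic_point_Suc_diff[of a b n i] by (smt (verit) divide_nonneg_nonneg zero_le_power)

lemma dyadic_sum_eq_RS_sum:
  "dyadic_sum f g a b n = RS_sum f g (2 ^ n) (dyadic_point a b n) (dyadic_point a b n)"
  by (simp add: dyadic_sum_def RS_sum_def)

lemma tagged_partition_dyadic: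
  assumes "a \<le> b" "(b - a) / 2 ^ n < \<delta>"
  shows "tagged_partition a b \<delta> (2 ^ n) (dyadic_point a b n) (dyadic_point a b n)"
  using assms by (simp add: tagged_partition_def dyadic_point_Suc_diff dyadic_point_mono_Suc)

text \<open>
  A fine partition of \<open>[a, s]\<close> followed by a dyadic partition of \<open>[s, t]\<close> is a fine partition of
  \<open>[a, t]\<close>. This identifies the increment of the indefinite integral over \<open>[s, t]\<close> as a limit of
  sums that only see \<open>f\<close> and \<open>g\<close> on \<open>[s, t]\<close>, so that local Hoelder constants can be used there.
\<close>

lemma has_RS_integral_dyadic:
  fixes f :: "real \<Rightarrow> 'a::real_normed_vector"
  assumes I: "has_RS_integral f g a s I" and J: "has_RS_integral f g a t J" and "a \<le> s" "s \<le> t"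
  shows "(\<lambda>n. dyadic_sum f g s t n) \<longlonglongrightarrow> J - I"
proof (rule LIMSEQ_I)
  fix \<epsilon> :: real assume "0 < \<epsilon>"
  then have "0 < \<epsilon> / 2" by simp
  obtain \<delta>1 where \<delta>1: "0 < \<delta>1"
      "\<And>n u \<xi>. tagged_partition a s \<delta>1 n u \<xi> \<Longrightarrow> norm (RS_sum f g n u \<xi> - I) < \<epsilon> / 2"
    using has_RS_integralE[OF I \<open>0 < \<epsilon> / 2\<close>] by blast
  obtain \<delta>2 where \<delta>2: "0 < \<delta>2"
      "\<And>n u \<xi>. tagged_partition a t \<delta>2 n u \<xi> \<Longrightarrow> norm (RS_sum f g n u \<xi> - J) < \<epsilon> / 2"
    using has_RS_integralE[OF J \<open>0 < \<epsilon> / 2\<close>] by blast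
  obtain m where m: "(s - a) / 2 ^ m < min \<delta>1 \<delta>2"
    using ex_dyadic_mesh[of "min \<delta>1 \<delta>2" s a] \<delta>1(1) \<delta>2(1) by auto
  obtain N where N: "(t - s) / 2 ^ N < \<delta>2"
    using ex_dyadic_mesh[of \<delta>2 t s] \<delta>2(1) by auto
  have "norm (dyadic_sum f g s t n - (J - I)) < \<epsilon>" if "N \<le> n" for n
  proof -
    have n: "(t - s) / 2 ^ n < \<delta>2"
    proof -
      have "(t - s) / 2 ^ n \<le> (t - s) / 2 ^ N"
        using \<open>s \<le> t\<close> that by (intro divide_left_mono) (auto intro: power_increasing)
      with N show ?thesis by simp
    qed
    have left: "norm (dyadic_sum f g a s m - I) < \<epsilon> / 2"
      unfolding dyadic_sum_eq_RS_sum
      using m by (intro \<delta>1(2) tagged_partition_dyadic \<open>a \<le> s\<close>) auto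
    define u where "u i = (if i \<le> 2 ^ m then dyadic_point a s m i else dyadic_point s t n (i - 2 ^ m))" for i
    have u_left: "u i = dyadic_point a s m i" if "i \<le> 2 ^ m" for i
      using that by (simp add: u_def)
    have u_right: "u (2 ^ m + i) = dyadic_point s t n i" for i
      by (cases "i = 0") (simp_all add: u_def)
    have step: "u i \<le> u (Suc i) \<and> u (Suc i) - u i < \<delta>2" for i
    proof (cases "i < 2 ^ m")
      case True
      then show ?thesis
        using m \<open>a \<le> s\<close> by (auto simp: u_left dyadic_point_Suc_diff dyadic_point_mono_Suc)
    next
      case False
      then obtain k where "i = 2 ^ m + k"
        using le_Suc_ex not_le by blast
      then show ?thesis
        using n \<open>s \<le> t\<close> u_right[of k] u_right[of "Suc k"]
        by (auto simp: dyadic_point_Suc_diff dyadic_point_mono_Suc)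
    qed
    have "tagged_partition a t \<delta>2 (2 ^ m + 2 ^ n) u u"
      using step u_left[of 0] u_right[of "2 ^ n"] by (simp add: tagged_partition_def)
    from \<delta>2(2)[OF this]
    have total: "norm (RS_sum f g (2 ^ m + 2 ^ n) u u - J) < \<epsilon> / 2" .
    have "RS_sum f g (2 ^ m + 2 ^ n) u u
        = (\<Sum>i<2 ^ m. (g (u (Suc i)) - g (u i)) *\<^sub>R f (u i))
          + (\<Sum>i<2 ^ n. (g (u (2 ^ m + Suc i)) - g (u (2 ^ m + i))) *\<^sub>R f (u (2 ^ m + i)))"
      by (simp add: RS_sum_def sum_lessThan_add)
    also have "\<dots> = dyadic_sum f g a s m + dyadic_sum f g s t n"
      unfolding u_right dyadic_sum_def by (simp add: u_left)
    finally have "norm (dyadic_sum f g a s m + dyadic_sum f g s t n - J) < \<epsilon> / 2"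
      using total by simp
    with left have "norm ((dyadic_sum f g a s m + dyadic_sum f g s t n - J) - (dyadic_sum f g a s m - I)) < \<epsilon>"
      by (smt (verit) norm_triangle_ineq4 field_sum_of_halves)
    then show ?thesis
      by (simp add: algebra_simps)
  qed
  then show "\<exists>N. \<forall>n\<ge>N. norm (dyadic_sum f g s t n - (J - I)) < \<epsilon>"
    by blast
qed

text \<open>
  The Young-Loeve inequality: the dyadic sums start at \<open>(g t - g s) *\<^sub>R f s\<close> and converge to the
  integral, and the distance travelled is bounded by a geometric series.
\<close>

lemma young_estimate:
  fixes f :: "real \<Rightarrow> 'a::real_normed_vector"
  assumes "has_RS_integral f g a s I" "has_RS_integral f g a t J" "a \<le> s" "s \<le> t"
    and "0 \<le> F" "0 \<le> K" "1 / 2 < \<gamma>"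
    and "holder_bound F \<gamma> {s..t} f" "holder_bound K \<gamma> {s..t} g"
  shows "norm (J - I - (g t - g s) *\<^sub>R f s) \<le> young_const \<gamma> * F * K * (t - s) powr (2 * \<gamma>)"
proof (rule LIMSEQ_le_const2)
  show "(\<lambda>n. norm (dyadic_sum f g s t n - (g t - g s) *\<^sub>R f s)) \<longlonglongrightarrow> norm (J - I - (g t - g s) *\<^sub>R f s)"
    by (intro tendsto_intros has_RS_integral_dyadic[OF assms(1-4)])
qed (use dyadic_sum_bound assms in blast)

section \<open>Passing to the limit in Riemann-Stieltjes integrals\<close>

lemma tagged_partition_mono:
  assumes "tagged_partition a b \<delta> n u \<xi>" "i \<le> j" "j \<le> n"
  shows "u i \<le> u j"
  using assms(2,3)
proof (induction j rule: dec_induct)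
  case (step k)
  with assms(1) have "u k \<le> \<xi> k" "\<xi> k \<le> u (Suc k)"
    by (auto simp: tagged_partition_def)
  with step show ?case by simp
qed simp

text \<open>
  On each cell, moving the tag and replacing the summand by the integral both cost a multiple of the
  cell length to the power \<open>2 * \<gamma>\<close>; one factor of the length sums up to \<open>b - a\<close>, the others are
  bounded by a power of the mesh. The point is that \<open>f\<close> enters only through its Hoelder constant, so that the
  error is uniform over families of integrands with a common constant.
\<close>

lemma RS_sum_error:
  fixes f :: "real \<Rightarrow> 'a::real_normed_vector"
  assumes I: "\<And>r. r \<in> {a..b} \<Longrightarrow> has_RS_integral f g a r (I r)"
    and "0 \<le> F" "0 \<le> K" "1 / 2 < \<gamma>"
    and f: "holder_bound F \<gamma> {a..b} f" and g: "holder_bound K \<gamma> {a..b} g"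
    and part: "tagged_partition a b \<delta> n u \<xi>"
  shows "norm (RS_sum f g n u \<xi> - I b) \<le> (1 + young_const \<gamma>) * F * K * \<delta> powr (2 * \<gamma> - 1) * (b - a)"
proof -
  have ends: "u 0 = a" "u n = b"
    using part by (auto simp: tagged_partition_def)
  have u_mem: "u i \<in> {a..b}" if "i \<le> n" for i
    using tagged_partition_mono[OF part, of 0 i] tagged_partition_mono[OF part, of i n] that ends by auto
  have "a \<le> b"
    using u_mem[of 0] by auto
  have "I a = 0"
    using has_RS_integral_refl_eq_0[OF I] \<open>a \<le> b\<close> by simp
  have "I b = (\<Sum>i<n. I (u (Suc i)) - I (u i))"
    using sum_lessThan_telescope[of "\<lambda>i. I (u i)" n] ends \<open>I a = 0\<close> by simp
  then have "RS_sum f g n u \<xi> - I b =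
      (\<Sum>i<n. (g (u (Suc i)) - g (u i)) *\<^sub>R f (\<xi> i) - (I (u (Suc i)) - I (u i)))"
    by (simp add: RS_sum_def sum_subtractf)
  also have "norm \<dots> \<le> (\<Sum>i<n. (1 + young_const \<gamma>) * F * K * \<delta> powr (2 * \<gamma> - 1) * (u (Suc i) - u i))"
  proof (rule sum_norm_le)
    fix i assume "i \<in> {..<n}"
    then have i: "u i \<le> \<xi> i" "\<xi> i \<le> u (Suc i)" "u (Suc i) - u i < \<delta>"
      using part by (auto simp: tagged_partition_def)
    have mem: "u i \<in> {a..b}" "u (Suc i) \<in> {a..b}" "\<xi> i \<in> {a..b}"
      using u_mem[of i] u_mem[of "Suc i"] i \<open>i \<in> {..<n}\<close> by auto
    define \<Delta> where "\<Delta> = u (Suc i) - u i"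
    have \<Delta>: "0 \<le> \<Delta>" "\<Delta> < \<delta>"
      using i by (auto simp: \<Delta>_def)
    have "norm ((g (u (Suc i)) - g (u i)) *\<^sub>R (f (\<xi> i) - f (u i))) \<le> (K * \<Delta> powr \<gamma>) * (F * \<Delta> powr \<gamma>)"
      unfolding norm_scaleR
    proof (rule mult_mono)
      show "\<bar>g (u (Suc i)) - g (u i)\<bar> \<le> K * \<Delta> powr \<gamma>"
        using holder_boundD[OF g mem(2,1)] \<Delta> by (simp add: \<Delta>_def)
      have "norm (f (\<xi> i) - f (u i)) \<le> F * \<bar>\<xi> i - u i\<bar> powr \<gamma>"
        by (rule holder_boundD[OF f mem(3,1)])
      also have "\<dots> \<le> F * \<Delta> powr \<gamma>"
        using assms(2,4) i by (intro mult_left_mono powr_mono2) (auto simp: \<Delta>_def)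
      finally show "norm (f (\<xi> i) - f (u i)) \<le> F * \<Delta> powr \<gamma>" .
    qed (use assms in auto)
    also have "\<dots> = F * K * \<Delta> powr (2 * \<gamma>)"
      using powr_add[of \<Delta> \<gamma> \<gamma>] by (simp add: mult_ac)
    finally have tag: "norm ((g (u (Suc i)) - g (u i)) *\<^sub>R (f (\<xi> i) - f (u i))) \<le> F * K * \<Delta> powr (2 * \<gamma>)" .
    have young: "norm (I (u (Suc i)) - I (u i) - (g (u (Suc i)) - g (u i)) *\<^sub>R f (u i))
        \<le> young_const \<gamma> * F * K * \<Delta> powr (2 * \<gamma>)"
      unfolding \<Delta>_def
      by (rule young_estimate[OF I[OF mem(1)] I[OF mem(2)]])
         (use assms i mem in \<open>auto intro: holder_bound_subset[OF f] holder_bound_subset[OF g]\<close>)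
    have "(g (u (Suc i)) - g (u i)) *\<^sub>R f (\<xi> i) - (I (u (Suc i)) - I (u i))
        = (g (u (Suc i)) - g (u i)) *\<^sub>R (f (\<xi> i) - f (u i))
          - (I (u (Suc i)) - I (u i) - (g (u (Suc i)) - g (u i)) *\<^sub>R f (u i))"
      by (simp add: algebra_simps)
    also have "norm \<dots> \<le> F * K * \<Delta> powr (2 * \<gamma>) + young_const \<gamma> * F * K * \<Delta> powr (2 * \<gamma>)"
      by (rule order_trans[OF norm_triangle_ineq4 add_mono[OF tag young]])
    also have "\<dots> = (1 + young_const \<gamma>) * F * K * (\<Delta> powr (2 * \<gamma> - 1) * \<Delta>)"
      using powr_mult_base[of \<Delta> "2 * \<gamma> - 1"] \<Delta>(1) by (simp add: algebra_simps)
    also have "\<dots> \<le> (1 + young_const \<gamma>) * F * K * (\<delta> powr (2 * \<gamma> - 1) * \<Delta>)"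
      using \<Delta> assms(2-4) young_const_pos[OF assms(4)]
      by (intro mult_left_mono mult_right_mono powr_mono2) auto
    finally show "norm ((g (u (Suc i)) - g (u i)) *\<^sub>R f (\<xi> i) - (I (u (Suc i)) - I (u i)))
        \<le> (1 + young_const \<gamma>) * F * K * \<delta> powr (2 * \<gamma> - 1) * (u (Suc i) - u i)"
      by (simp add: \<Delta>_def mult_ac)
  qed
  also have "\<dots> = (1 + young_const \<gamma>) * F * K * \<delta> powr (2 * \<gamma> - 1) * (b - a)"
    using sum_lessThan_telescope[of u n] ends by (simp add: sum_distrib_left[symmetric])
  finally show ?thesis .
qed

text \<open>
  By the uniform error bound, limits along the sequence and along partitions may be exchanged:
  each Riemann-Stieltjes sum is a finite sum and converges by pointwise convergence alone.
\<close>

lemma has_RS_integral_limit: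
  fixes f :: "nat \<Rightarrow> real \<Rightarrow> 'a::banach"
  assumes I: "\<And>k r. r \<in> {a..b} \<Longrightarrow> has_RS_integral (f k) g a r (I k r)"
    and "a \<le> b" "0 \<le> F" "0 \<le> K" "1 / 2 < \<gamma>"
    and f: "\<And>k. holder_bound F \<gamma> {a..b} (f k)" and g: "holder_bound K \<gamma> {a..b} g"
    and lim: "\<And>r. r \<in> {a..b} \<Longrightarrow> (\<lambda>k. f k r) \<longlonglongrightarrow> f' r"
  shows "\<exists>J. (\<lambda>k. I k b) \<longlonglongrightarrow> J \<and> has_RS_integral f' g a b J"
proof -
  define err where "err \<delta> = (1 + young_const \<gamma>) * F * K * \<delta> powr (2 * \<gamma> - 1) * (b - a)" for \<delta>
  have error: "norm (RS_sum (f k) g n u \<xi> - I k b) \<le> err \<delta>" if "tagged_partition a b \<delta> n u \<xi>" for k n u \<xi> \<delta>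
    unfolding err_def using that by (intro RS_sum_error I f g assms) auto
  have sums: "(\<lambda>k. RS_sum (f k) g n u \<xi>) \<longlonglongrightarrow> RS_sum f' g n u \<xi>"
    if part: "tagged_partition a b \<delta> n u \<xi>" for n u \<xi> \<delta>
    unfolding RS_sum_def
  proof (intro tendsto_sum tendsto_scaleR tendsto_const lim)
    fix i assume "i \<in> {..<n}"
    then show "\<xi> i \<in> {a..b}"
      using part tagged_partition_mono[OF part, of 0 i] tagged_partition_mono[OF part, of "Suc i" n]
      by (force simp: tagged_partition_def)
  qed
  have small: "\<exists>\<delta>>0. err \<delta> < \<epsilon>" if "0 < \<epsilon>" for \<epsilon>
  proof -
    have "((\<lambda>\<delta>. err \<delta>) \<longlongrightarrow> (1 + young_const \<gamma>) * F * K * 0 * (b - a)) (at_right 0)"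
      unfolding err_def
    proof (intro tendsto_mult tendsto_const)
      show "((\<lambda>\<delta>::real. \<delta> powr (2 * \<gamma> - 1)) \<longlongrightarrow> 0) (at_right 0)"
      proof -
        have "\<forall>\<^sub>F \<delta> in at_right 0. 0 \<le> (\<delta>::real)"
          using eventually_at_right_less by (rule eventually_mono) simp
        then show ?thesis
          using tendsto_powr'[OF tendsto_ident_at tendsto_const[of "2 * \<gamma> - 1"], of "0::real" "{0<..}"] \<open>1 / 2 < \<gamma>\<close>
          by simp
      qed
    qed
    then have "\<forall>\<^sub>F \<delta> in at_right 0. err \<delta> < \<epsilon>"
      using that by (intro order_tendstoD(2)) auto
    moreover have "\<forall>\<^sub>F \<delta> in at_right 0. 0 < (\<delta>::real)"
      by (rule eventually_at_right_less)
    ultimately have "\<forall>\<^sub>F \<delta> in at_right 0. 0 < \<delta> \<and> err \<delta> < \<epsilon>"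
      by eventually_elim simp
    then show ?thesis
      using eventually_happens' trivial_limit_at_right_real by blast
  qed
  have "Cauchy (\<lambda>k. I k b)"
  proof (rule metric_CauchyI)
    fix \<epsilon> :: real assume "0 < \<epsilon>"
    then obtain \<delta> where \<delta>: "0 < \<delta>" "err \<delta> < \<epsilon> / 3"
      using small[of "\<epsilon> / 3"] by auto
    obtain m where m: "(b - a) / 2 ^ m < \<delta>"
      using ex_dyadic_mesh[OF \<delta>(1)] by blast
    define S where "S k = RS_sum (f k) g (2 ^ m) (dyadic_point a b m) (dyadic_point a b m)" for k
    note part = tagged_partition_dyadic[OF \<open>a \<le> b\<close> m]
    have "Cauchy S"
      unfolding S_def by (rule LIMSEQ_imp_Cauchy[OF sums[OF part]])
    then obtain N where N: "dist (S k) (S l) < \<epsilon> / 3" if "k \<ge> N" "l \<ge> N" for k l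
      using \<open>0 < \<epsilon>\<close> metric_CauchyD[of S "\<epsilon> / 3"] by auto
    have "dist (I k b) (I l b) < \<epsilon>" if "k \<ge> N" "l \<ge> N" for k l
    proof -
      have "dist (S k) (I k b) < \<epsilon> / 3" "dist (S l) (I l b) < \<epsilon> / 3"
        using error[OF part, of k] error[OF part, of l] \<delta>(2) by (auto simp: S_def dist_norm)
      then show ?thesis
        using N[OF that] dist_triangle[of "I k b" "I l b" "S k"] dist_triangle[of "S k" "I l b" "S l"]
        by (simp add: dist_commute)
    qed
    then show "\<exists>N. \<forall>k\<ge>N. \<forall>l\<ge>N. dist (I k b) (I l b) < \<epsilon>"
      by blast
  qed
  then obtain J where J: "(\<lambda>k. I k b) \<longlonglongrightarrow> J"
    using Cauchy_convergent convergent_def by blast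
  have "has_RS_integral f' g a b J"
    unfolding has_RS_integral_iff
  proof (intro allI impI)
    fix \<epsilon> :: real assume "0 < \<epsilon>"
    then obtain \<delta> where \<delta>: "0 < \<delta>" "err \<delta> < \<epsilon>"
      using small by blast
    have "norm (RS_sum f' g n u \<xi> - J) < \<epsilon>" if part: "tagged_partition a b \<delta> n u \<xi>" for n u \<xi>
    proof -
      have "norm (RS_sum f' g n u \<xi> - J) \<le> err \<delta>"
        by (rule LIMSEQ_le_const2[OF tendsto_norm[OF tendsto_diff[OF sums[OF part] J]]])
           (use error[OF part] in blast)
      with \<delta>(2) show ?thesis by simp
    qed
    with \<delta>(1) show "\<exists>\<delta>>0. \<forall>n u \<xi>. tagged_partition a b \<delta> n u \<xi> \<longrightarrow> norm (RS_sum f' g n u \<xi> - J) < \<epsilon>"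
      by blast
  qed
  with J show ?thesis by blast
qed

lemma has_RS_integral_scale_integrator:
  fixes f :: "real \<Rightarrow> 'a::real_normed_vector"
  assumes "has_RS_integral f g a b I"
  shows "has_RS_integral f (\<lambda>s. r * g s) a b (r *\<^sub>R I)"
  unfolding has_RS_integral_iff
proof (intro allI impI)
  fix \<epsilon> :: real assume "0 < \<epsilon>"
  then have "0 < \<epsilon> / (\<bar>r\<bar> + 1)" by simp
  then obtain \<delta> where "0 < \<delta>" and
    \<delta>: "\<And>n u \<xi>. tagged_partition a b \<delta> n u \<xi> \<Longrightarrow> norm (RS_sum f g n u \<xi> - I) < \<epsilon> / (\<bar>r\<bar> + 1)"
    using has_RS_integralE[OF assms] by blast
  have "norm (RS_sum f (\<lambda>s. r * g s) n u \<xi> - r *\<^sub>R I) < \<epsilon>"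
    if part: "tagged_partition a b \<delta> n u \<xi>" for n u \<xi>
  proof -
    have "RS_sum f (\<lambda>s. r * g s) n u \<xi> - r *\<^sub>R I = r *\<^sub>R (RS_sum f g n u \<xi> - I)"
      by (simp add: RS_sum_def scaleR_sum_right scaleR_diff_right right_diff_distrib[symmetric])
    also have "norm \<dots> \<le> \<bar>r\<bar> * (\<epsilon> / (\<bar>r\<bar> + 1))"
      unfolding norm_scaleR using less_imp_le[OF \<delta>[OF part]] by (intro mult_left_mono) auto
    also have "\<dots> < \<epsilon>"
      using \<open>0 < \<epsilon>\<close> by (simp add: field_simps)
    finally show ?thesis .
  qed
  with \<open>0 < \<delta>\<close> show "\<exists>\<delta>>0. \<forall>n u \<xi>. tagged_partition a b \<delta> n u \<xi> \<longrightarrow>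
      norm (RS_sum f (\<lambda>s. r * g s) n u \<xi> - r *\<^sub>R I) < \<epsilon>"
    by blast
qed

text \<open>
  Moves the coefficient in front of the stochastic integral into its driving signal, which turns the
  equation for \<open>X y\<close> into the one driven by \<open>sqrt y\<close> times the fractional Brownian motion.
\<close>

lemma path_equation_scale_driver:
  fixes x0 :: "real ^ 'n" and z :: "real \<Rightarrow> real ^ 'd"
  assumes "path_equation T x0 c V0 V z x"
  shows "path_equation T x0 1 V0 V (\<lambda>t. c *\<^sub>R z t) x"
  unfolding path_equation_def
proof
  fix t assume "t \<in> {0..T}"
  then obtain J where J: "\<And>j. has_RS_integral (\<lambda>s. V j (x s)) (\<lambda>s. z s $ j) 0 t (J j)"
    and x: "x t = x0 + c *\<^sub>R (\<Sum>j\<in>UNIV. J j) + integral {0..t} (\<lambda>s. V0 (x s))"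
    using assms unfolding path_equation_def by blast
  have "has_RS_integral (\<lambda>s. V j (x s)) (\<lambda>s. (c *\<^sub>R z s) $ j) 0 t (c *\<^sub>R J j)" for j
    using has_RS_integral_scale_integrator[OF J] by simp
  with x show "\<exists>J. (\<forall>j. has_RS_integral (\<lambda>s. V j (x s)) (\<lambda>s. (c *\<^sub>R z s) $ j) 0 t (J j)) \<and>
      x t = x0 + 1 *\<^sub>R (\<Sum>j\<in>UNIV. J j) + integral {0..t} (\<lambda>s. V0 (x s))"
    by (intro exI[of _ "\<lambda>j. c *\<^sub>R J j"]) (simp add: scaleR_sum_right)
qed

section \<open>A priori bounds and limits of pathwise equations\<close>

text \<open>
  The Hoelder constant \<open>C\<close> of the solution on \<open>[s, t]\<close> appears only together with the higher power
  \<open>2 * \<gamma>\<close> of \<open>t - s\<close>. This is what allows it to be absorbed on short intervals.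
\<close>

lemma path_equation_increment:
  fixes x0 :: "real ^ 'n" and z :: "real \<Rightarrow> real ^ 'd"
  assumes eq: "path_equation T x0 c V0 V z x"
    and A: "\<And>v. norm (V0 v) \<le> A" "\<And>j v. norm (V j v) \<le> A"
    and L: "\<And>j u v. norm (V j u - V j v) \<le> L * norm (u - v)" and "0 \<le> L"
    and V0: "continuous_on UNIV V0"
    and z: "\<And>j. holder_bound K \<gamma> {0..T} (\<lambda>s. z s $ j)" and "0 \<le> K" "1 / 2 < \<gamma>"
    and cont: "continuous_on {0..T} x"
    and st: "0 \<le> s" "s \<le> t" "t \<le> T"
    and x: "holder_bound C \<gamma> {s..t} x" "0 \<le> C"
  shows "norm (x t - x s) \<le> \<bar>c\<bar> * real CARD('d) *
           (A * K * (t - s) powr \<gamma> + young_const \<gamma> * (L * C) * K * (t - s) powr (2 * \<gamma>)) + A * (t - s)"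
proof -
  obtain J where J: "\<And>j. has_RS_integral (\<lambda>r. V j (x r)) (\<lambda>r. z r $ j) 0 s (J j)"
    and xs: "x s = x0 + c *\<^sub>R (\<Sum>j\<in>UNIV. J j) + integral {0..s} (\<lambda>r. V0 (x r))"
    using eq st unfolding path_equation_def by force
  obtain J' where J': "\<And>j. has_RS_integral (\<lambda>r. V j (x r)) (\<lambda>r. z r $ j) 0 t (J' j)"
    and xt: "x t = x0 + c *\<^sub>R (\<Sum>j\<in>UNIV. J' j) + integral {0..t} (\<lambda>r. V0 (x r))"
    using eq st unfolding path_equation_def by force
  have cont': "continuous_on {0..t} (\<lambda>r. V0 (x r))"
    by (rule continuous_on_compose2[OF V0 continuous_on_subset[OF cont]]) (use st in auto)
  have "integral {0..t} (\<lambda>r. V0 (x r)) - integral {0..s} (\<lambda>r. V0 (x r)) = integral {s..t} (\<lambda>r. V0 (x r))"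
    using Henstock_Kurzweil_Integration.integral_combine[OF st(1,2) integrable_continuous_interval[OF cont']]
    by (simp add: algebra_simps)
  moreover have "norm (integral {s..t} (\<lambda>r. V0 (x r))) \<le> A * (t - s)"
    by (rule integral_bound[OF st(2)]) (use A(1) st in \<open>auto intro!: continuous_on_subset[OF cont']\<close>)
  ultimately have drift: "norm (integral {0..t} (\<lambda>r. V0 (x r)) - integral {0..s} (\<lambda>r. V0 (x r))) \<le> A * (t - s)"
    by simp
  have noise: "norm (J' j - J j) \<le> A * K * (t - s) powr \<gamma> + young_const \<gamma> * (L * C) * K * (t - s) powr (2 * \<gamma>)" for j
  proof -
    have "holder_bound (L * C) \<gamma> {s..t} (\<lambda>r. V j (x r))"
      unfolding holder_bound_def
    proof (intro ballI)
      fix p q assume "p \<in> {s..t}" "q \<in> {s..t}"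
      then have "norm (V j (x p) - V j (x q)) \<le> L * (C * \<bar>p - q\<bar> powr \<gamma>)"
        using \<open>0 \<le> L\<close> by (intro order_trans[OF L] mult_left_mono holder_boundD[OF x(1)])
      then show "norm (V j (x p) - V j (x q)) \<le> L * C * \<bar>p - q\<bar> powr \<gamma>"
        by (simp add: mult_ac)
    qed
    then have young: "norm (J' j - J j - (z t $ j - z s $ j) *\<^sub>R V j (x s))
        \<le> young_const \<gamma> * (L * C) * K * (t - s) powr (2 * \<gamma>)"
      using st x assms(5,8,9)
      by (intro young_estimate[OF J J']) (auto intro: holder_bound_subset[OF z])
    have "\<bar>z t $ j - z s $ j\<bar> \<le> K * (t - s) powr \<gamma>"
      using holder_boundD[OF z, of t s j] st by simp
    then have "norm ((z t $ j - z s $ j) *\<^sub>R V j (x s)) \<le> (K * (t - s) powr \<gamma>) * A"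
      unfolding norm_scaleR using \<open>0 \<le> K\<close> A(2) by (intro mult_mono) auto
    moreover have "norm (J' j - J j) \<le> norm (J' j - J j - (z t $ j - z s $ j) *\<^sub>R V j (x s))
        + norm ((z t $ j - z s $ j) *\<^sub>R V j (x s))"
      using norm_triangle_ineq[of "J' j - J j - (z t $ j - z s $ j) *\<^sub>R V j (x s)"
          "(z t $ j - z s $ j) *\<^sub>R V j (x s)"] by simp
    ultimately show ?thesis
      using young by (simp add: mult_ac)
  qed
  have "x t - x s = c *\<^sub>R (\<Sum>j\<in>UNIV. J' j - J j)
      + (integral {0..t} (\<lambda>r. V0 (x r)) - integral {0..s} (\<lambda>r. V0 (x r)))"
    unfolding xt xs by (simp add: sum_subtractf algebra_simps)
  also have "norm \<dots> \<le> \<bar>c\<bar> * norm (\<Sum>j\<in>UNIV. J' j - J j) + A * (t - s)"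
    by (rule order_trans[OF norm_triangle_ineq]) (use drift in simp)
  also have "norm (\<Sum>j\<in>UNIV. J' j - J j) \<le> (\<Sum>j\<in>(UNIV::'d set).
      A * K * (t - s) powr \<gamma> + young_const \<gamma> * (L * C) * K * (t - s) powr (2 * \<gamma>))"
    by (rule sum_norm_le) (rule noise)
  also have "\<dots> = real CARD('d) * (A * K * (t - s) powr \<gamma> + young_const \<gamma> * (L * C) * K * (t - s) powr (2 * \<gamma>))"
    by simp
  finally show ?thesis
    by (simp add: mult_left_mono mult.assoc)
qed

lemma holder_bound_from_short_scale:
  fixes x :: "real \<Rightarrow> 'a::real_normed_vector"
  assumes "0 < h" "0 \<le> C" "0 \<le> \<gamma>" "T \<le> real N * h"
    and short: "\<And>s t. 0 \<le> s \<Longrightarrow> s \<le> t \<Longrightarrow> t \<le> T \<Longrightarrow> t - s \<le> h \<Longrightarrow> norm (x t - x s) \<le> C * (t - s) powr \<gamma>"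
  shows "holder_bound (real N * C) \<gamma> {0..T} x"
proof (rule holder_boundI_ordered)
  fix s t assume st: "s \<in> {0..T}" "t \<in> {0..T}" "s < t"
  have "N \<noteq> 0"
    using assms(1,4) st by (intro notI) auto
  define p where "p i = s + (t - s) * (real i / real N)" for i
  have diff: "p (Suc i) - p i = (t - s) / real N" for i
    by (simp add: p_def add_divide_distrib distrib_left)
  have piece: "norm (x (p (Suc i)) - x (p i)) \<le> C * (t - s) powr \<gamma>" if "i < N" for i
  proof -
    have "0 \<le> (t - s) / real N"
      using st by simp
    then have "p i \<le> p (Suc i)"
      using diff[of i] by linarith
    moreover have "s \<le> p i"
      using st by (simp add: p_def)
    moreover have "p (Suc i) \<le> s + (t - s) * 1"
      unfolding p_def using st that by (intro add_left_mono mult_left_mono) (auto simp: field_simps)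
    moreover have "(t - s) / real N \<le> h"
      using st assms(4) \<open>N \<noteq> 0\<close> by (simp add: field_simps)
    ultimately have "norm (x (p (Suc i)) - x (p i)) \<le> C * ((t - s) / real N) powr \<gamma>"
      using short[of "p i" "p (Suc i)"] st diff[of i] by auto
    also have "\<dots> \<le> C * (t - s) powr \<gamma>"
    proof -
      have "(t - s) / real N \<le> (t - s) / 1"
        using st \<open>N \<noteq> 0\<close> by (intro divide_left_mono) auto
      then show ?thesis
        using st assms(2,3) by (intro mult_left_mono powr_mono2) auto
    qed
    finally show ?thesis .
  qed
  have "x t - x s = (\<Sum>i<N. x (p (Suc i)) - x (p i))"
    using sum_lessThan_telescope[of "\<lambda>i. x (p i)" N] \<open>N \<noteq> 0\<close> by (simp add: p_def)
  also have "norm \<dots> \<le> (\<Sum>i<N. C * (t - s) powr \<gamma>)"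
    by (rule sum_norm_le) (use piece in auto)
  finally show "norm (x t - x s) \<le> real N * C * (t - s) powr \<gamma>"
    by simp
qed

text \<open>
  On intervals of a suitable length \<open>h\<close> the increment estimate turns a Hoelder constant \<open>C\<close> of a
  solution into \<open>a + C / 2\<close>, where \<open>a\<close> and \<open>h\<close> depend on the data only. Iterating from the finite but
  uncontrolled constant that a solution has by assumption gives the constant \<open>2 * a\<close> in the limit.
  Chaining short intervals then covers \<open>[0, T]\<close>.
\<close>

lemma path_equation_apriori_bound:
  fixes x0 :: "real ^ 'n" and z :: "real \<Rightarrow> real ^ 'd"
  assumes "0 < T" "0 \<le> cmax"
    and A: "\<And>v. norm (V0 v) \<le> A" "\<And>j v. norm (V j v) \<le> A"
    and L: "\<And>j u v. norm (V j u - V j v) \<le> L * norm (u - v)" and "0 \<le> L"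
    and V0: "continuous_on UNIV V0"
    and z: "\<And>j. holder_bound K \<gamma> {0..T} (\<lambda>s. z s $ j)" and "0 \<le> K" "1 / 2 < \<gamma>" "\<gamma> < 1"
  obtains D where "0 \<le> D"
    and "\<And>c x. \<bar>c\<bar> \<le> cmax \<Longrightarrow> holder_on \<gamma> {0..T} x \<Longrightarrow> path_equation T x0 c V0 V z x \<Longrightarrow>
           holder_bound D \<gamma> {0..T} x"
proof -
  have "0 \<le> A"
    using order_trans[OF norm_ge_zero A(1)] .
  define Q where "Q = cmax * real CARD('d) * (young_const \<gamma> * L * K)"
  have "0 \<le> Q"
    using assms young_const_pos[OF \<open>1 / 2 < \<gamma>\<close>] by (simp add: Q_def)
  \<comment> \<open>\<open>Q\<close> is the coefficient of \<open>C\<close> in the increment estimate, and \<open>h\<close> is chosen such that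
    \<open>Q * h powr \<gamma> \<le> 1 / 2\<close>.\<close>
  define h where "h = (1 / (2 * (Q + 1))) powr (1 / \<gamma>)"
  have "0 < h"
    using \<open>0 \<le> Q\<close> by (simp add: h_def)
  have h_powr: "h powr \<gamma> = 1 / (2 * (Q + 1))"
    using \<open>0 \<le> Q\<close> \<open>1 / 2 < \<gamma>\<close> by (simp add: h_def powr_powr)
  define a where "a = cmax * real CARD('d) * (A * K) + A * T powr (1 - \<gamma>)"
  have "0 \<le> a"
    using assms \<open>0 \<le> A\<close> by (simp add: a_def)
  obtain N :: nat where N: "T / h < real N"
    using reals_Archimedean2 by blast
  define D where "D = real N * (2 * a)"
  have "holder_bound D \<gamma> {0..T} x"
    if c: "\<bar>c\<bar> \<le> cmax" and hol: "holder_on \<gamma> {0..T} x" and eq: "path_equation T x0 c V0 V z x" for c x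
  proof -
    define short where "short C \<longleftrightarrow> (\<forall>s t. 0 \<le> s \<longrightarrow> s \<le> t \<longrightarrow> t \<le> T \<longrightarrow> t - s \<le> h \<longrightarrow>
        norm (x t - x s) \<le> C * (t - s) powr \<gamma>)" for C
    obtain C0 where C0: "0 \<le> C0" "holder_bound C0 \<gamma> {0..T} x"
      using hol unfolding holder_on_iff_holder_bound by blast
    have cont: "continuous_on {0..T} x"
      using holder_bound_continuous_on[OF C0(2)] \<open>1 / 2 < \<gamma>\<close> by simp
    have improve: "short (a + C / 2)" if "short C" "0 \<le> C" for C
      unfolding short_def
    proof (intro allI impI)
      fix s t :: real assume st: "0 \<le> s" "s \<le> t" "t \<le> T" "t - s \<le> h"
      have local: "holder_bound C \<gamma> {s..t} x"
        by (rule holder_boundI_ordered) (use \<open>short C\<close> st in \<open>auto simp: short_def\<close>)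
      define e where "e = (t - s) powr \<gamma>"
      have "0 \<le> e"
        by (simp add: e_def)
      have ee: "(t - s) powr (2 * \<gamma>) = e * e"
        using powr_add[of "t - s" \<gamma> \<gamma>] by (simp add: e_def)
      have "e \<le> 1 / (2 * (Q + 1))"
        unfolding e_def h_powr[symmetric] using st \<open>1 / 2 < \<gamma>\<close> by (intro powr_mono2) auto
      then have "Q * e \<le> Q * (1 / (2 * (Q + 1)))"
        using \<open>0 \<le> Q\<close> by (rule mult_left_mono)
      also have "\<dots> \<le> 1 / 2"
        using \<open>0 \<le> Q\<close> by (simp add: field_simps)
      finally have Qe: "Q * e \<le> 1 / 2" .
      have "t - s = (t - s) powr (1 - \<gamma>) * e"
        using st powr_add[of "t - s" "1 - \<gamma>" \<gamma>] by (simp add: e_def)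
      also have "\<dots> \<le> T powr (1 - \<gamma>) * e"
        using st \<open>\<gamma> < 1\<close> \<open>0 \<le> e\<close> by (intro mult_right_mono powr_mono2) auto
      finally have lin: "t - s \<le> T powr (1 - \<gamma>) * e" .
      have "norm (x t - x s) \<le> \<bar>c\<bar> * real CARD('d) *
           (A * K * e + young_const \<gamma> * (L * C) * K * (e * e)) + A * (t - s)"
        using path_equation_increment[OF eq A L \<open>0 \<le> L\<close> V0 z \<open>0 \<le> K\<close> \<open>1 / 2 < \<gamma>\<close> cont st(1-3) local \<open>0 \<le> C\<close>]
        unfolding ee e_def[symmetric] by simp
      also have "\<dots> \<le> cmax * real CARD('d) *
           (A * K * e + young_const \<gamma> * (L * C) * K * (e * e)) + A * (T powr (1 - \<gamma>) * e)"
        using c lin \<open>0 \<le> A\<close> \<open>0 \<le> K\<close> \<open>0 \<le> L\<close> \<open>0 \<le> C\<close> \<open>0 \<le> e\<close> young_const_pos[OF \<open>1 / 2 < \<gamma>\<close>]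
        by (intro add_mono mult_left_mono mult_right_mono add_nonneg_nonneg mult_nonneg_nonneg) auto
      also have "\<dots> = a * e + C * (Q * e) * e"
        by (simp add: a_def Q_def algebra_simps)
      also have "\<dots> \<le> a * e + C * (1 / 2) * e"
        using Qe \<open>0 \<le> C\<close> \<open>0 \<le> e\<close> by (intro add_left_mono mult_right_mono mult_left_mono) auto
      finally show "norm (x t - x s) \<le> (a + C / 2) * (t - s) powr \<gamma>"
        by (simp add: e_def algebra_simps)
    qed
    have iterate: "short (2 * a + C0 / 2 ^ n)" for n
    proof (induction n)
      case 0
      have "norm (x t - x s) \<le> (2 * a + C0) * (t - s) powr \<gamma>" if "0 \<le> s" "s \<le> t" "t \<le> T" for s t
      proof -
        have "norm (x t - x s) \<le> C0 * (t - s) powr \<gamma>"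
          using holder_boundD[OF C0(2), of t s] that by simp
        also have "\<dots> \<le> (2 * a + C0) * (t - s) powr \<gamma>"
          using \<open>0 \<le> a\<close> by (intro mult_right_mono) auto
        finally show ?thesis .
      qed
      then show ?case
        by (simp add: short_def)
    next
      case (Suc n)
      from improve[OF Suc] show ?case
        using \<open>0 \<le> a\<close> C0(1) by (simp add: field_simps)
    qed
    have "norm (x t - x s) \<le> (2 * a) * (t - s) powr \<gamma>"
      if "0 \<le> s" "s \<le> t" "t \<le> T" "t - s \<le> h" for s t
    proof (rule LIMSEQ_le_const)
      have "(\<lambda>n. (2 * a + C0 * (1 / 2) ^ n) * (t - s) powr \<gamma>) \<longlonglongrightarrow> (2 * a + C0 * 0) * (t - s) powr \<gamma>"
        by (intro tendsto_intros LIMSEQ_realpow_zero) auto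
      then show "(\<lambda>n. (2 * a + C0 / 2 ^ n) * (t - s) powr \<gamma>) \<longlonglongrightarrow> (2 * a) * (t - s) powr \<gamma>"
        by (simp add: power_one_over)
    qed (use iterate that in \<open>auto simp: short_def\<close>)
    moreover have "T \<le> real N * h"
      using N \<open>0 < h\<close> by (simp add: field_simps)
    ultimately show ?thesis
      unfolding D_def using \<open>0 < h\<close> \<open>0 \<le> a\<close> \<open>1 / 2 < \<gamma>\<close>
      by (intro holder_bound_from_short_scale) auto
  qed
  moreover have "0 \<le> D"
    using \<open>0 \<le> a\<close> by (simp add: D_def)
  ultimately show thesis
    using that by blast
qed

text \<open>
  Pointwise limits of solutions are solutions. Boundedness of the coefficients \<open>c k\<close> makes the a priori
  bound uniform in \<open>k\<close>; hence so are the Hoelder constants of the integrands, the stochastic integrals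
  converge, and the drift integrals converge by dominated convergence.
\<close>

lemma path_equation_limit:
  fixes x0 :: "real ^ 'n" and z :: "real \<Rightarrow> real ^ 'd"
  assumes "0 < T"
    and A: "\<And>v. norm (V0 v) \<le> A" "\<And>j v. norm (V j v) \<le> A"
    and L: "\<And>j u v. norm (V j u - V j v) \<le> L * norm (u - v)" and "0 \<le> L"
    and V0: "continuous_on UNIV V0"
    and z: "\<And>j. holder_bound K \<gamma> {0..T} (\<lambda>s. z s $ j)" and "0 \<le> K" "1 / 2 < \<gamma>" "\<gamma> < 1"
    and x: "\<And>k. holder_on \<gamma> {0..T} (x k)" "\<And>k. path_equation T x0 (c k) V0 V z (x k)"
    and c: "c \<longlonglongrightarrow> c'"
    and lim: "\<And>t. t \<in> {0..T} \<Longrightarrow> (\<lambda>k. x k t) \<longlonglongrightarrow> x' t"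
  shows "holder_on \<gamma> {0..T} x' \<and> path_equation T x0 c' V0 V z x'"
proof
  obtain cmax where cmax: "\<bar>c k\<bar> \<le> cmax" for k
    using convergent_imp_Bseq[OF convergentI[OF c]] unfolding Bseq_def by auto
  then have "0 \<le> cmax"
    using abs_ge_zero order_trans by blast
  obtain D where "0 \<le> D"
    and apriori: "\<And>c x. \<bar>c\<bar> \<le> cmax \<Longrightarrow> holder_on \<gamma> {0..T} x \<Longrightarrow> path_equation T x0 c V0 V z x \<Longrightarrow>
           holder_bound D \<gamma> {0..T} x"
    by (rule path_equation_apriori_bound
        [where V = V and ?x0.0 = x0,
         OF \<open>0 < T\<close> \<open>0 \<le> cmax\<close> A L \<open>0 \<le> L\<close> V0 z \<open>0 \<le> K\<close> \<open>1 / 2 < \<gamma>\<close> \<open>\<gamma> < 1\<close>]) blast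
  have D: "holder_bound D \<gamma> {0..T} (x k)" for k
    by (rule apriori[OF cmax x])
  have "holder_bound D \<gamma> {0..T} x'"
    unfolding holder_bound_def
  proof (intro ballI)
    fix s t assume st: "s \<in> {0..T}" "t \<in> {0..T}"
    show "norm (x' s - x' t) \<le> D * \<bar>s - t\<bar> powr \<gamma>"
      by (rule LIMSEQ_le_const2[OF tendsto_norm[OF tendsto_diff[OF lim[OF st(1)] lim[OF st(2)]]]])
         (use holder_boundD[OF D st] in blast)
  qed
  then show "holder_on \<gamma> {0..T} x'"
    using \<open>0 \<le> D\<close> unfolding holder_on_iff_holder_bound by blast
  have V_lim: "(\<lambda>k. V j (x k r)) \<longlonglongrightarrow> V j (x' r)" if "r \<in> {0..T}" for j r
  proof -
    have "(\<lambda>k. L * norm (x k r - x' r)) \<longlonglongrightarrow> L * norm (x' r - x' r)"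
      by (intro tendsto_intros lim that)
    then have "(\<lambda>k. L * norm (x k r - x' r)) \<longlonglongrightarrow> 0"
      by simp
    then have "(\<lambda>k. V j (x k r) - V j (x' r)) \<longlonglongrightarrow> 0"
      by (rule Lim_null_comparison[rotated]) (simp add: L)
    then show ?thesis
      by (simp add: LIM_zero_iff)
  qed
  have V_holder: "holder_bound (L * D) \<gamma> {0..T} (\<lambda>r. V j (x k r))" for j k
    unfolding holder_bound_def
  proof (intro ballI)
    fix s t assume "s \<in> {0..T}" "t \<in> {0..T}"
    then have "norm (V j (x k s) - V j (x k t)) \<le> L * (D * \<bar>s - t\<bar> powr \<gamma>)"
      using \<open>0 \<le> L\<close> by (intro order_trans[OF L] mult_left_mono holder_boundD[OF D])
    then show "norm (V j (x k s) - V j (x k t)) \<le> L * D * \<bar>s - t\<bar> powr \<gamma>"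
      by (simp add: mult_ac)
  qed
  obtain J where J: "\<And>k t j. t \<in> {0..T} \<Longrightarrow> has_RS_integral (\<lambda>r. V j (x k r)) (\<lambda>r. z r $ j) 0 t (J k t j)"
    and xJ: "\<And>k t. t \<in> {0..T} \<Longrightarrow>
      x k t = x0 + c k *\<^sub>R (\<Sum>j\<in>UNIV. J k t j) + integral {0..t} (\<lambda>r. V0 (x k r))"
  proof -
    have "\<forall>k t. \<exists>J. t \<in> {0..T} \<longrightarrow> (\<forall>j. has_RS_integral (\<lambda>r. V j (x k r)) (\<lambda>r. z r $ j) 0 t (J j)) \<and>
      x k t = x0 + c k *\<^sub>R (\<Sum>j\<in>UNIV. J j) + integral {0..t} (\<lambda>r. V0 (x k r))"
      using x(2) unfolding path_equation_def by blast
    then obtain J where "\<forall>k t. t \<in> {0..T} \<longrightarrow>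
      (\<forall>j. has_RS_integral (\<lambda>r. V j (x k r)) (\<lambda>r. z r $ j) 0 t (J k t j)) \<and>
      x k t = x0 + c k *\<^sub>R (\<Sum>j\<in>UNIV. J k t j) + integral {0..t} (\<lambda>r. V0 (x k r))"
      by metis
    then show thesis
      using that[of "\<lambda>k t j. J k t j"] by blast
  qed
  show "path_equation T x0 c' V0 V z x'"
    unfolding path_equation_def
  proof
    fix t assume t: "t \<in> {0..T}"
    have "\<exists>J'. (\<lambda>k. J k t j) \<longlonglongrightarrow> J' \<and> has_RS_integral (\<lambda>r. V j (x' r)) (\<lambda>r. z r $ j) 0 t J'" for j
    proof (rule has_RS_integral_limit[where I = "\<lambda>k r. J k r j" and f = "\<lambda>k r. V j (x k r)"])
      show "holder_bound (L * D) \<gamma> {0..t} (\<lambda>r. V j (x k r))" for k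
        using t by (intro holder_bound_subset[OF V_holder]) auto
      show "holder_bound K \<gamma> {0..t} (\<lambda>r. z r $ j)"
        using t by (intro holder_bound_subset[OF z]) auto
    qed (use t J V_lim \<open>0 \<le> L\<close> \<open>0 \<le> D\<close> \<open>0 \<le> K\<close> \<open>1 / 2 < \<gamma>\<close> in auto)
    then obtain J' where J': "\<And>j. (\<lambda>k. J k t j) \<longlonglongrightarrow> J' j"
        "\<And>j. has_RS_integral (\<lambda>r. V j (x' r)) (\<lambda>r. z r $ j) 0 t (J' j)"
      by metis
    have drift: "(\<lambda>k. integral {0..t} (\<lambda>r. V0 (x k r))) \<longlonglongrightarrow> integral {0..t} (\<lambda>r. V0 (x' r))"
    proof (rule dominated_convergence(2)[where h = "\<lambda>_. A"])
      show "(\<lambda>r. V0 (x k r)) integrable_on {0..t}" for k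
        using t \<open>1 / 2 < \<gamma>\<close>
        by (intro integrable_continuous_interval continuous_on_compose2[OF V0 
              continuous_on_subset[OF holder_bound_continuous_on[OF D[of k]]]]) auto
      show "(\<lambda>k. V0 (x k r)) \<longlonglongrightarrow> V0 (x' r)" if "r \<in> {0..t}" for r
        using continuous_on_tendsto_compose[OF V0 lim] t that by auto
    qed (use A(1) in auto)
    have "(\<lambda>k. x0 + c k *\<^sub>R (\<Sum>j\<in>UNIV. J k t j) + integral {0..t} (\<lambda>r. V0 (x k r)))
        \<longlonglongrightarrow> x0 + c' *\<^sub>R (\<Sum>j\<in>UNIV. J' j) + integral {0..t} (\<lambda>r. V0 (x' r))"
      by (intro tendsto_intros c J'(1) drift)
    then have "x' t = x0 + c' *\<^sub>R (\<Sum>j\<in>UNIV. J' j) + integral {0..t} (\<lambda>r. V0 (x' r))"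
      using lim[OF t] xJ[OF t] by (intro LIMSEQ_unique) auto
    with J'(2) show "\<exists>J. (\<forall>j. has_RS_integral (\<lambda>r. V j (x' r)) (\<lambda>r. z r $ j) 0 t (J j)) \<and>
        x' t = x0 + c' *\<^sub>R (\<Sum>j\<in>UNIV. J j) + integral {0..t} (\<lambda>r. V0 (x' r))"
      by blast
  qed
qed

section \<open>Moments of fractional Brownian increments\<close>

lemma gaussian_rv_integrable:
  assumes "prob_space M" "gaussian_rv M Z"
  shows "integrable M Z" "integrable M (\<lambda>\<omega>. (Z \<omega>)\<^sup>2)"
proof -
  interpret prob_space M by fact
  have Z: "Z \<in> borel_measurable M"
    using assms(2) by (simp add: gaussian_rv_def)
  have "integrable M Z \<and> integrable M (\<lambda>\<omega>. (Z \<omega>)\<^sup>2)"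
    using assms(2) unfolding gaussian_rv_def
  proof (elim conjE disjE exE)
    fix \<mu> \<sigma> :: real
    assume \<sigma>: "0 < \<sigma>" and D: "distributed M lborel Z (\<lambda>x. ennreal (normal_density \<mu> \<sigma> x))"
    have 1: "integrable lborel (\<lambda>x. normal_density \<mu> \<sigma> x * x)"
      using normal_moment_nz_1[OF \<sigma>] by (rule integrable.intros)
    have 0: "integrable lborel (normal_density \<mu> \<sigma>)"
      using \<sigma> by simp
    have 2: "integrable lborel (\<lambda>x. normal_density \<mu> \<sigma> x * (x - \<mu>)\<^sup>2)"
      using normal_moment_even[OF \<sigma>, of \<mu> 1] by (auto dest: integrable.intros)
    have "integrable lborel (\<lambda>x. normal_density \<mu> \<sigma> x * (x - \<mu>)\<^sup>2
        + 2 * \<mu> * (normal_density \<mu> \<sigma> x * x) - \<mu>\<^sup>2 * normal_density \<mu> \<sigma> x)"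
      by (intro Bochner_Integration.integrable_add Bochner_Integration.integrable_diff integrable_mult_right 0 1 2)
    then have "integrable lborel (\<lambda>x. normal_density \<mu> \<sigma> x * x\<^sup>2)"
      by (rule back_subst) (auto simp: fun_eq_iff power2_eq_square algebra_simps)
    then show ?thesis
      using 1 distributed_integrable[OF D, of "\<lambda>x. x"] distributed_integrable[OF D, of "\<lambda>x. x\<^sup>2"] by simp
  next
    fix \<mu> assume \<mu>: "AE \<omega> in M. Z \<omega> = \<mu>"
    have "integrable M Z \<longleftrightarrow> integrable M (\<lambda>_. \<mu>)"
      using \<mu> Z by (intro integrable_cong_AE) auto
    moreover have "integrable M (\<lambda>\<omega>. (Z \<omega>)\<^sup>2) \<longleftrightarrow> integrable M (\<lambda>_. \<mu>\<^sup>2)"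
      using \<mu> Z by (intro integrable_cong_AE) auto
    ultimately show ?thesis
      by simp
  qed
  then show "integrable M Z" "integrable M (\<lambda>\<omega>. (Z \<omega>)\<^sup>2)"
    by auto
qed

text \<open>
  The assumption on the variance excludes the degenerate constants, and the mean and the variance
  then determine the normal law and all its moments.
\<close>

lemma gaussian_rv_even_moment:
  assumes "prob_space M" "gaussian_rv M Z"
    and mean: "integral\<^sup>L M Z = 0" and var: "integral\<^sup>L M (\<lambda>\<omega>. (Z \<omega>)\<^sup>2) = v" and "0 < v"
  shows "integrable M (\<lambda>\<omega>. Z \<omega> ^ (2 * k))"
    and "integral\<^sup>L M (\<lambda>\<omega>. Z \<omega> ^ (2 * k)) = fact (2 * k) / (2 ^ k * fact k) * v ^ k"
proof -
  interpret prob_space M by fact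
  have Z: "Z \<in> borel_measurable M"
    using assms(2) by (simp add: gaussian_rv_def)
  have "integrable M (\<lambda>\<omega>. Z \<omega> ^ (2 * k)) \<and>
      integral\<^sup>L M (\<lambda>\<omega>. Z \<omega> ^ (2 * k)) = fact (2 * k) / (2 ^ k * fact k) * v ^ k"
    using assms(2) unfolding gaussian_rv_def
  proof (elim conjE disjE exE)
    fix \<mu> \<sigma> :: real
    assume \<sigma>: "0 < \<sigma>" and D: "distributed M lborel Z (\<lambda>x. ennreal (normal_density \<mu> \<sigma> x))"
    have "\<mu> = 0"
      using distributed_integral[OF D, of "\<lambda>x. x"] mean
        has_bochner_integral_integral_eq[OF normal_moment_nz_1[OF \<sigma>, of \<mu>]] by simp
    have "\<sigma>\<^sup>2 = v"
      using distributed_integral[OF D, of "\<lambda>x. x\<^sup>2"] var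
        has_bochner_integral_integral_eq[OF normal_moment_even[OF \<sigma>, of \<mu> 1]] \<open>\<mu> = 0\<close> by simp
    have "integrable M (\<lambda>\<omega>. Z \<omega> ^ (2 * k))"
      using distributed_integrable[OF D, of "\<lambda>x. x ^ (2 * k)"]
        integrable.intros[OF normal_moment_even[OF \<sigma>, of \<mu> k]] \<open>\<mu> = 0\<close> by simp
    moreover have "integral\<^sup>L M (\<lambda>\<omega>. Z \<omega> ^ (2 * k)) = fact (2 * k) / ((2 / \<sigma>\<^sup>2) ^ k * fact k)"
      using distributed_integral[OF D, of "\<lambda>x. x ^ (2 * k)"]
        has_bochner_integral_integral_eq[OF normal_moment_even[OF \<sigma>, of \<mu> k]] \<open>\<mu> = 0\<close> by simp
    ultimately show ?thesis
      unfolding \<open>\<sigma>\<^sup>2 = v\<close> using \<open>0 < v\<close> by (simp add: power_divide)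
  next
    fix \<mu> assume \<mu>: "AE \<omega> in M. Z \<omega> = \<mu>"
    have "integral\<^sup>L M Z = integral\<^sup>L M (\<lambda>_. \<mu>)"
      using \<mu> Z by (intro integral_cong_AE) auto
    moreover have "integral\<^sup>L M (\<lambda>\<omega>. (Z \<omega>)\<^sup>2) = integral\<^sup>L M (\<lambda>_. \<mu>\<^sup>2)"
      using \<mu> Z by (intro integral_cong_AE) auto
    ultimately have False
      using mean var \<open>0 < v\<close> by (simp add: prob_space)
    then show ?thesis ..
  qed
  then show "integrable M (\<lambda>\<omega>. Z \<omega> ^ (2 * k))"
    and "integral\<^sup>L M (\<lambda>\<omega>. Z \<omega> ^ (2 * k)) = fact (2 * k) / (2 ^ k * fact k) * v ^ k"
    by auto
qed

lemma fBm_gaussian_rv: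
  assumes "fBm M H b" "0 \<le> t"
  shows "gaussian_rv M (b t)"
proof -
  have "\<And>J c. finite J \<Longrightarrow> J \<subseteq> {0..} \<Longrightarrow> gaussian_rv M (\<lambda>\<omega>. \<Sum>r\<in>J. c r * b r \<omega>)"
    using assms(1) unfolding fBm_def gaussian_process_def by blast
  from this[of "{t}" "\<lambda>_. 1"] show ?thesis
    using assms(2) by simp
qed

text \<open>
  The covariance function gives the increment the variance \<open>(t - s) powr (2 * H)\<close> by polarization; it
  is Gaussian as a linear combination of two values of the process.
\<close>

lemma fBm_increment_moment:
  assumes "prob_space M" "fBm M H b" "0 \<le> s" "s < t"
  shows "integrable M (\<lambda>\<omega>. (b t \<omega> - b s \<omega>) ^ (2 * k))"
    and "integral\<^sup>L M (\<lambda>\<omega>. (b t \<omega> - b s \<omega>) ^ (2 * k))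
           = fact (2 * k) / (2 ^ k * fact k) * ((t - s) powr (2 * H)) ^ k"
proof -
  interpret prob_space M by fact
  have "0 \<le> t"
    using assms by simp
  note G = fBm_gaussian_rv[OF assms(2) \<open>0 \<le> t\<close>] fBm_gaussian_rv[OF assms(2) \<open>0 \<le> s\<close>]
  note int = gaussian_rv_integrable[OF \<open>prob_space M\<close> G(1)] gaussian_rv_integrable[OF \<open>prob_space M\<close> G(2)]
  have meas: "b t \<in> borel_measurable M" "b s \<in> borel_measurable M"
    using G by (auto simp: gaussian_rv_def)
  have int_prod: "integrable M (\<lambda>\<omega>. b s \<omega> * b t \<omega>)"
  proof (rule Bochner_Integration.integrable_bound)
    show "integrable M (\<lambda>\<omega>. (b t \<omega>)\<^sup>2 + (b s \<omega>)\<^sup>2)"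
      using int by simp
    have "\<bar>x * y\<bar> \<le> y\<^sup>2 + x\<^sup>2" for x y :: real
    proof -
      have "0 \<le> (\<bar>x\<bar> - \<bar>y\<bar>)\<^sup>2" "0 \<le> \<bar>x\<bar> * \<bar>y\<bar>"
        by simp_all
      then show ?thesis
        unfolding power2_diff power2_abs abs_mult by linarith
    qed
    then show "AE \<omega> in M. norm (b s \<omega> * b t \<omega>) \<le> norm ((b t \<omega>)\<^sup>2 + (b s \<omega>)\<^sup>2)"
      by (intro AE_I2) (auto intro: order_trans[OF _ abs_ge_self])
  qed (use meas in measurable)
  have gauss: "gaussian_rv M (\<lambda>\<omega>. b t \<omega> - b s \<omega>)"
  proof -
    have "\<And>J c. finite J \<Longrightarrow> J \<subseteq> {0..} \<Longrightarrow> gaussian_rv M (\<lambda>\<omega>. \<Sum>r\<in>J. c r * b r \<omega>)"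
      using assms(2) unfolding fBm_def gaussian_process_def by blast
    from this[of "{t, s}" "\<lambda>r. if r = t then 1 else -1"]
    have "gaussian_rv M (\<lambda>\<omega>. \<Sum>r\<in>{t, s}. (if r = t then 1 else -1) * b r \<omega>)"
      using \<open>0 \<le> s\<close> \<open>0 \<le> t\<close> by simp
    then show ?thesis
      using \<open>s < t\<close> by simp
  qed
  have mean: "integral\<^sup>L M (\<lambda>\<omega>. b t \<omega> - b s \<omega>) = 0"
    using assms(2) int \<open>0 \<le> s\<close> \<open>0 \<le> t\<close> by (simp add: fBm_def)
  have cov: "integral\<^sup>L M (\<lambda>\<omega>. b p \<omega> * b q \<omega>) = (q powr (2 * H) + p powr (2 * H) - \<bar>q - p\<bar> powr (2 * H)) / 2"
    if "0 \<le> p" "0 \<le> q" for p q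
    using assms(2) that unfolding fBm_def by blast
  have "integral\<^sup>L M (\<lambda>\<omega>. (b t \<omega> - b s \<omega>)\<^sup>2)
      = integral\<^sup>L M (\<lambda>\<omega>. (b t \<omega>)\<^sup>2 + (b s \<omega>)\<^sup>2 - 2 * (b s \<omega> * b t \<omega>))"
    by (simp add: power2_eq_square algebra_simps)
  also have "\<dots> = integral\<^sup>L M (\<lambda>\<omega>. (b t \<omega>)\<^sup>2) + integral\<^sup>L M (\<lambda>\<omega>. (b s \<omega>)\<^sup>2)
      - 2 * integral\<^sup>L M (\<lambda>\<omega>. b s \<omega> * b t \<omega>)"
    using int int_prod by simp
  also have "\<dots> = (t - s) powr (2 * H)"
    using cov[of s t] cov[of s s] cov[of t t] \<open>0 \<le> s\<close> \<open>0 \<le> t\<close> \<open>s < t\<close> by (simp add: power2_eq_square)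
  finally have var: "integral\<^sup>L M (\<lambda>\<omega>. (b t \<omega> - b s \<omega>)\<^sup>2) = (t - s) powr (2 * H)" .
  have pos: "0 < (t - s) powr (2 * H)"
    using \<open>s < t\<close> by simp
  show "integrable M (\<lambda>\<omega>. (b t \<omega> - b s \<omega>) ^ (2 * k))"
    and "integral\<^sup>L M (\<lambda>\<omega>. (b t \<omega> - b s \<omega>) ^ (2 * k))
           = fact (2 * k) / (2 ^ k * fact k) * ((t - s) powr (2 * H)) ^ k"
    using gaussian_rv_even_moment[OF \<open>prob_space M\<close> gauss mean var pos] by blast+
qed

section \<open>Hoelder paths of fractional Brownian motion\<close>

text \<open>
  Chaining. For \<open>2 ^ (- n - 1) < t - s \<le> 2 ^ (- n)\<close> round both points down to the grid of mesh
  \<open>2 ^ (- n)\<close>: the rounded points coincide or are neighbours. Passing from the rounding at one level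
  to that at the next moves by at most one cell of the finer grid, so by continuity the distance
  from \<open>g s\<close> to its rounded value is bounded by a geometric series.
\<close>

lemma holder_bound_from_dyadic_increments:
  fixes g :: "real \<Rightarrow> 'a::real_normed_vector"
  assumes cont: "continuous_on {0..1} g" and "0 < \<gamma>" "0 \<le> K"
    and incr: "\<And>n i. i < 2 ^ n \<Longrightarrow> norm (g (real (Suc i) / 2 ^ n) - g (real i / 2 ^ n)) \<le> K * (2 powr - \<gamma>) ^ n"
  shows "holder_bound (K * (1 + 2 / (1 - 2 powr - \<gamma>)) * 2 powr \<gamma>) \<gamma> {0..1} g"
proof -
  define r :: real where "r = 2 powr - \<gamma>"
  have r: "0 \<le> r" "r < 1"
    using powr_less_mono[of "- \<gamma>" 0 "2::real"] \<open>0 < \<gamma>\<close> by (auto simp: r_def)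
  define d where "d m s = nat \<lfloor>s * 2 ^ m\<rfloor>" for m and s :: real
  define q where "q m s = real (d m s) / 2 ^ m" for m s
  have d: "real (d m s) \<le> s * 2 ^ m" "s * 2 ^ m < real (d m s) + 1" if "0 \<le> s" for m s
    using that by (auto simp: d_def)
  have q_bounds: "q m s \<le> s" "s - 1 / 2 ^ m \<le> q m s" "0 \<le> q m s" if "0 \<le> s" for m s
  proof -
    have "real (d m s) = q m s * 2 ^ m"
      by (simp add: q_def)
    with d[OF that, of m] have "q m s * 2 ^ m \<le> s * 2 ^ m" "(s - q m s) * 2 ^ m \<le> 1"
      by (auto simp: left_diff_distrib)
    then have "q m s \<le> s" "s - q m s \<le> 1 / 2 ^ m"
      by (auto simp: pos_le_divide_eq)
    then show "q m s \<le> s" "s - 1 / 2 ^ m \<le> q m s" "0 \<le> q m s"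
      by (auto simp: q_def)
  qed
  have d_le: "d m s \<le> 2 ^ m" if "0 \<le> s" "s \<le> 1" for m s
  proof -
    have "real (d m s) \<le> 1 * 2 ^ m"
      using that by (intro order_trans[OF d(1)] mult_right_mono) auto
    then show ?thesis
      by simp
  qed
  have step: "norm (g (q (Suc m) s) - g (q m s)) \<le> K * r ^ Suc m" if s: "0 \<le> s" "s \<le> 1" for m s
  proof -
    have "real (d (Suc m) s) < 2 * real (d m s) + 2" "2 * real (d m s) < real (d (Suc m) s) + 1"
      using d[OF s(1), of m] d[OF s(1), of "Suc m"] by auto
    then have "d (Suc m) s = 2 * d m s \<or> d (Suc m) s = Suc (2 * d m s)"
      by linarith
    moreover have q_m: "q m s = real (2 * d m s) / 2 ^ Suc m"
      by (simp add: q_def)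
    ultimately show ?thesis
    proof (elim disjE)
      assume "d (Suc m) s = 2 * d m s"
      then have "q (Suc m) s = q m s"
        by (simp add: q_def)
      then show ?thesis
        using r \<open>0 \<le> K\<close> by simp
    next
      assume *: "d (Suc m) s = Suc (2 * d m s)"
      then have "2 * d m s < 2 ^ Suc m"
        using d_le[OF s, of "Suc m"] by simp
      from incr[OF this] show ?thesis
        unfolding q_m unfolding q_def * r_def .
    qed
  qed
  have tail: "norm (g s - g (q n s)) \<le> K * r ^ n / (1 - r)" if s: "s \<in> {0..1}" for n s
  proof -
    have s': "0 \<le> s" "s \<le> 1"
      using s by auto
    have "(\<lambda>m. q m s) \<longlonglongrightarrow> s"
    proof (rule tendsto_sandwich)
      have "(\<lambda>m. s - (1 / 2) ^ m) \<longlonglongrightarrow> s - 0"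
        by (intro tendsto_intros LIMSEQ_realpow_zero) auto
      then show "(\<lambda>m. s - 1 / 2 ^ m) \<longlonglongrightarrow> s"
        by (simp add: power_one_over)
    qed (use q_bounds[OF s'(1)] in auto)
    then have "(\<lambda>m. g (q m s)) \<longlonglongrightarrow> g s"
    proof (rule continuous_on_tendsto_compose[OF cont _ s])
      show "\<forall>\<^sub>F m in sequentially. q m s \<in> {0..1}"
        using q_bounds(1,3)[OF s'(1)] s'(2) by (intro always_eventually) (meson atLeastAtMost_iff order_trans)
    qed
    then have "(\<lambda>j. norm (g (q (n + j) s) - g (q n s))) \<longlonglongrightarrow> norm (g s - g (q n s))"
      using LIMSEQ_ignore_initial_segment[of "\<lambda>m. g (q m s)" "g s" n]
      by (intro tendsto_intros) (simp add: add.commute)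
    moreover have "norm (g (q (n + j) s) - g (q n s)) \<le> K * r ^ n / (1 - r)" for j
    proof -
      have "g (q (n + j) s) - g (q n s) = (\<Sum>i<j. g (q (Suc (n + i)) s) - g (q (n + i) s))"
        using sum_lessThan_telescope[of "\<lambda>i. g (q (n + i) s)" j] by simp
      also have "norm \<dots> \<le> (\<Sum>i<j. K * r ^ n * r ^ i)"
      proof (rule sum_norm_le)
        fix i
        have "K * r ^ Suc (n + i) \<le> K * r ^ (n + i)"
          using r \<open>0 \<le> K\<close> by (intro mult_left_mono power_decreasing) auto
        then show "norm (g (q (Suc (n + i)) s) - g (q (n + i) s)) \<le> K * r ^ n * r ^ i"
          using step[OF s', of "n + i"] by (simp add: power_add mult_ac)
      qed
      also have "\<dots> = K * r ^ n * ((1 - r ^ j) / (1 - r))"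
        using r by (simp add: sum_distrib_left[symmetric] sum_gp_strict)
      also have "\<dots> \<le> K * r ^ n * (1 / (1 - r))"
        using r \<open>0 \<le> K\<close> by (intro mult_left_mono divide_right_mono) auto
      finally show ?thesis
        by simp
    qed
    ultimately show ?thesis
      by (intro LIMSEQ_le_const2) auto
  qed
  show ?thesis
    unfolding r_def[symmetric]
  proof (rule holder_boundI_ordered)
    fix s t :: real assume st: "s \<in> {0..1}" "t \<in> {0..1}" "s < t"
    define N where "N = (LEAST N. 1 / 2 ^ N < t - s)"
    have ex: "1 / 2 ^ N < t - s"
      unfolding N_def by (rule LeastI_ex) (use ex_dyadic_mesh[of "t - s" 1 0] st in auto)
    have "N \<noteq> 0"
      using ex st by (intro notI) auto
    then obtain n where N: "N = Suc n"
      by (cases N) auto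
    have n: "t - s \<le> 1 / 2 ^ n"
      using not_less_Least[of n "\<lambda>N. 1 / 2 ^ N < t - s"] N unfolding N_def by linarith
    have "t * 2 ^ n \<le> s * 2 ^ n + 1"
      using n by (simp add: field_simps)
    then have "real (d n t) < real (d n s) + 2"
      using d[of s n] d[of t n] st by auto
    moreover have "d n s \<le> d n t"
      unfolding d_def using st by (intro nat_mono floor_mono) auto
    ultimately have "d n t = d n s \<or> d n t = Suc (d n s)"
      by linarith
    then have mid: "norm (g (q n t) - g (q n s)) \<le> K * r ^ n"
    proof
      assume "d n t = Suc (d n s)"
      moreover from this have "d n s < 2 ^ n"
        using d_le[of t n] st by simp
      ultimately show ?thesis
        using incr[of "d n s" n] by (simp add: q_def r_def)
    qed (use r \<open>0 \<le> K\<close> in \<open>simp add: q_def\<close>)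
    have "norm (g t - g s) \<le> norm (g t - g (q n t)) + norm (g (q n t) - g (q n s)) + norm (g s - g (q n s))"
      using norm_triangle_ineq4[of "g t - g (q n t) + (g (q n t) - g (q n s))" "g s - g (q n s)"]
        norm_triangle_ineq[of "g t - g (q n t)" "g (q n t) - g (q n s)"] by simp
    also have "\<dots> \<le> K * r ^ n / (1 - r) + K * r ^ n + K * r ^ n / (1 - r)"
      by (intro add_mono mid tail st)
    also have "\<dots> = K * (1 + 2 / (1 - r)) * r ^ n"
      by (simp add: algebra_simps)
    also have "\<dots> \<le> K * (1 + 2 / (1 - r)) * (2 powr \<gamma> * (t - s) powr \<gamma>)"
    proof (rule mult_left_mono)
      have "r ^ n = (1 / 2 ^ n) powr \<gamma>"
      proof -
        have "(1 / 2 ^ n :: real) = 2 powr - real n"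
          by (simp add: powr_minus powr_realpow inverse_eq_divide)
        then show ?thesis
          by (simp add: r_def powr_powr powr_power mult.commute)
      qed
      also have "\<dots> \<le> (2 * (t - s)) powr \<gamma>"
        using ex \<open>0 < \<gamma>\<close> unfolding N by (intro powr_mono2) (auto simp: field_simps)
      also have "\<dots> = 2 powr \<gamma> * (t - s) powr \<gamma>"
        using st powr_mult[of 2 "t - s" \<gamma>] by simp
      finally show "r ^ n \<le> 2 powr \<gamma> * (t - s) powr \<gamma>" .
    qed (use r \<open>0 \<le> K\<close> in auto)
    finally show "norm (g t - g s) \<le> K * (1 + 2 / (1 - r)) * 2 powr \<gamma> * (t - s) powr \<gamma>"
      by (simp add: mult_ac)
  qed
qed

text \<open>
  Markov's inequality for an even power; the power \<open>k\<close> stays free because a large one is needed to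
  beat the number of cells of a dyadic grid.
\<close>

lemma fBm_large_increment_prob:
  assumes "prob_space M" "fBm M H b" "0 \<le> s" "s < t" "0 < \<epsilon>"
  shows "measure M {\<omega> \<in> space M. \<epsilon> \<le> \<bar>b t \<omega> - b s \<omega>\<bar>}
    \<le> fact (2 * k) / (2 ^ k * fact k) * ((t - s) powr (2 * H)) ^ k / \<epsilon> ^ (2 * k)"
proof -
  interpret prob_space M by fact
  note moment = fBm_increment_moment[OF assms(1-4), of k]
  have "measure M {\<omega> \<in> space M. \<epsilon> \<le> \<bar>b t \<omega> - b s \<omega>\<bar>}
      \<le> measure M {\<omega> \<in> space M. \<epsilon> ^ (2 * k) \<le> (b t \<omega> - b s \<omega>) ^ (2 * k)}"
  proof (rule finite_measure_mono)
    show "{\<omega> \<in> space M. \<epsilon> ^ (2 * k) \<le> (b t \<omega> - b s \<omega>) ^ (2 * k)} \<in> sets M"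
      using borel_measurable_integrable[OF moment(1)] by measurable
    have "\<epsilon> ^ (2 * k) \<le> z ^ (2 * k)" if "\<epsilon> \<le> \<bar>z\<bar>" for z
      using power_mono[OF that, of "2 * k"] \<open>0 < \<epsilon>\<close> by (simp add: power_even_abs)
    then show "{\<omega> \<in> space M. \<epsilon> \<le> \<bar>b t \<omega> - b s \<omega>\<bar>}
        \<subseteq> {\<omega> \<in> space M. \<epsilon> ^ (2 * k) \<le> (b t \<omega> - b s \<omega>) ^ (2 * k)}"
      by auto
  qed
  also have "\<dots> \<le> integral\<^sup>L M (\<lambda>\<omega>. (b t \<omega> - b s \<omega>) ^ (2 * k)) / \<epsilon> ^ (2 * k)"
    using \<open>0 < \<epsilon>\<close> by (intro integral_Markov_inequality_measure[OF moment(1) sets.empty_sets]) auto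
  finally show ?thesis
    unfolding moment(2) .
qed

text \<open>
  The Kolmogorov-Chentsov argument. By the Borel-Cantelli lemma almost every path has, at all but
  finitely many dyadic levels \<open>n\<close>, only increments below \<open>2 powr (- \<gamma> * n)\<close>. The finitely many remaining
  increments are absorbed in the constant, and chaining extends the bound to all pairs of times.
\<close>

lemma fBm_holder_paths:
  assumes "prob_space M" and fBm: "fBm M H b" and "0 < \<gamma>" "\<gamma> < H" "0 < T"
  shows "AE \<omega> in M. holder_on \<gamma> {0..T} (\<lambda>t. b t \<omega>)"
proof -
  interpret prob_space M by fact
  \<comment> \<open>With this power the union bound over the \<open>2 ^ n\<close> cells of level \<open>n\<close> is summable in \<open>n\<close>: it decays
    like \<open>2 powr (n * (1 - 2 * k * (H - \<gamma>)))\<close>.\<close>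
  obtain k :: nat where "1 / (2 * (H - \<gamma>)) < real k"
    using reals_Archimedean2 by blast
  then have k: "1 < 2 * real k * (H - \<gamma>)"
    using \<open>\<gamma> < H\<close> by (simp add: field_simps)
  define r :: real where "r = 2 powr - \<gamma>"
  have r: "0 < r"
    by (simp add: r_def)
  define m :: real where "m = fact (2 * k) / (2 ^ k * fact k)"
  define Z where "Z n i \<omega> = b (T * (real (Suc i) / 2 ^ n)) \<omega> - b (T * (real i / 2 ^ n)) \<omega>" for n i \<omega>
  define A where "A n = (\<Union>i<2 ^ n. {\<omega> \<in> space M. r ^ n \<le> \<bar>Z n i \<omega>\<bar>})" for n :: nat
  have meas_b: "b t \<in> borel_measurable M" if "0 \<le> t" for t
    using fBm_gaussian_rv[OF fBm that] by (simp add: gaussian_rv_def)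
  have [measurable]: "Z n i \<in> borel_measurable M" for n i
    unfolding Z_def using \<open>0 < T\<close> by (intro borel_measurable_diff meas_b) auto
  have A_sets: "A n \<in> sets M" for n
    unfolding A_def by measurable
  define \<rho> where "\<rho> = 2 powr (1 - 2 * real k * (H - \<gamma>))"
  have \<rho>: "0 \<le> \<rho>" "\<rho> < 1"
    using powr_less_mono[of "1 - 2 * real k * (H - \<gamma>)" 0 "2::real"] k by (auto simp: \<rho>_def)
  have A_bound: "measure M (A n) \<le> m * (T powr (2 * H)) ^ k * \<rho> ^ n" for n
  proof -
    have "measure M (A n) \<le> (\<Sum>i<(2::nat) ^ n. measure M {\<omega> \<in> space M. r ^ n \<le> \<bar>Z n i \<omega>\<bar>})"
      unfolding A_def by (intro measure_UNION_le) auto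
    also have "\<dots> \<le> (\<Sum>i<(2::nat) ^ n. m * ((T / 2 ^ n) powr (2 * H)) ^ k / (r ^ n) ^ (2 * k))"
    proof (rule sum_mono)
      fix i
      have "T * (real (Suc i) / 2 ^ n) - T * (real i / 2 ^ n) = T / 2 ^ n"
        by (simp add: add_divide_distrib distrib_left)
      moreover have "T * (real i / 2 ^ n) < T * (real (Suc i) / 2 ^ n)"
        using \<open>0 < T\<close> by (intro mult_strict_left_mono divide_strict_right_mono) auto
      ultimately show "measure M {\<omega> \<in> space M. r ^ n \<le> \<bar>Z n i \<omega>\<bar>}
          \<le> m * ((T / 2 ^ n) powr (2 * H)) ^ k / (r ^ n) ^ (2 * k)"
        using fBm_large_increment_prob[OF \<open>prob_space M\<close> fBm, of "T * (real i / 2 ^ n)"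
            "T * (real (Suc i) / 2 ^ n)" "r ^ n" k] r \<open>0 < T\<close>
        unfolding Z_def m_def by simp
    qed
    also have "\<dots> = m * (T powr (2 * H)) ^ k * (2 ^ n * ((1 / 2 ^ n) powr (2 * H)) ^ k / (r ^ n) ^ (2 * k))"
      using powr_mult[of T "1 / 2 ^ n" "2 * H"] \<open>0 < T\<close> by (simp add: power_mult_distrib)
    also have "2 ^ n * ((1 / 2 ^ n) powr (2 * H)) ^ k / (r ^ n) ^ (2 * k) = \<rho> ^ n"
    proof -
      have "(1 / 2 ^ n :: real) = 2 powr - real n" "(2::real) ^ n = 2 powr real n"
        by (simp_all add: powr_minus powr_realpow inverse_eq_divide)
      then have "2 ^ n * ((1 / 2 ^ n) powr (2 * H)) ^ k / (r ^ n) ^ (2 * k)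
          = 2 powr (real n + - real n * (2 * H) * real k - - \<gamma> * real n * real (2 * k))"
        unfolding r_def by (simp only: powr_powr powr_power powr_add powr_diff) (simp add: mult_ac)
      also have "\<dots> = 2 powr ((1 - 2 * real k * (H - \<gamma>)) * real n)"
        by (simp add: algebra_simps)
      also have "\<dots> = \<rho> ^ n"
        by (simp add: \<rho>_def powr_power mult.commute)
      finally show ?thesis .
    qed
    finally show ?thesis .
  qed
  have "summable (\<lambda>n. measure M (A n))"
  proof (rule summable_comparison_test')
    show "summable (\<lambda>n. m * (T powr (2 * H)) ^ k * \<rho> ^ n)"
      using \<rho> by (intro summable_mult summable_geometric) auto
  qed (use A_bound in simp)
  then have "AE \<omega> in M. eventually (\<lambda>n. \<omega> \<in> space M - A n) sequentially"
    by (intro borel_cantelli_AE1 A_sets) (auto simp: emeasure_eq_measure)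
  moreover have "AE \<omega> in M. continuous_on {0..} (\<lambda>t. b t \<omega>)"
    using fBm by (simp add: fBm_def)
  ultimately show ?thesis
  proof eventually_elim
    case (elim \<omega>)
    then obtain N where N: "\<And>n. N \<le> n \<Longrightarrow> \<omega> \<in> space M - A n"
      unfolding eventually_sequentially by blast
    define K where "K = 1 + (\<Sum>n<N. \<Sum>i<2 ^ n. \<bar>Z n i \<omega>\<bar> / r ^ n)"
    have "0 \<le> K"
      unfolding K_def using r by (intro add_nonneg_nonneg sum_nonneg divide_nonneg_nonneg) auto
    have "\<bar>Z n i \<omega>\<bar> \<le> K * r ^ n" if "i < 2 ^ n" for n i
    proof (cases "n < N")
      case True
      have "\<bar>Z n i \<omega>\<bar> / r ^ n \<le> (\<Sum>i<2 ^ n. \<bar>Z n i \<omega>\<bar> / r ^ n)"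
        using that r by (intro member_le_sum[where f = "\<lambda>i. \<bar>Z n i \<omega>\<bar> / r ^ n"]) auto
      also have "\<dots> \<le> (\<Sum>n<N. \<Sum>i<2 ^ n. \<bar>Z n i \<omega>\<bar> / r ^ n)"
        using True r by (intro member_le_sum[where f = "\<lambda>n. \<Sum>i<2 ^ n. \<bar>Z n i \<omega>\<bar> / r ^ n"] sum_nonneg) auto
      finally have "\<bar>Z n i \<omega>\<bar> / r ^ n \<le> K"
        by (simp add: K_def)
      then show ?thesis
        using r by (simp add: pos_divide_le_eq)
    next
      case False
      then have "\<omega> \<notin> A n"
        using N[of n] by simp
      then have "\<not> r ^ n \<le> \<bar>Z n i \<omega>\<bar>"
        using that N[of N] unfolding A_def by blast
      then have "\<bar>Z n i \<omega>\<bar> < r ^ n"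
        by simp
      also have "\<dots> \<le> K * r ^ n"
        using r unfolding K_def by (simp add: sum_nonneg)
      finally show ?thesis by simp
    qed
    then have "holder_bound (K * (1 + 2 / (1 - 2 powr - \<gamma>)) * 2 powr \<gamma>) \<gamma> {0..1} (\<lambda>t. b (T * t) \<omega>)"
    proof (intro holder_bound_from_dyadic_increments \<open>0 < \<gamma>\<close> \<open>0 \<le> K\<close>)
      show "continuous_on {0..1} (\<lambda>t. b (T * t) \<omega>)"
        by (rule continuous_on_compose2[OF elim(2)]) (use \<open>0 < T\<close> in \<open>auto intro!: continuous_intros\<close>)
    qed (auto simp: Z_def r_def)
    then obtain C where C: "holder_bound C \<gamma> {0..1} (\<lambda>t. b (T * t) \<omega>)"
      by blast
    have "\<bar>b s \<omega> - b t \<omega>\<bar> \<le> C / T powr \<gamma> * \<bar>s - t\<bar> powr \<gamma>" if "s \<in> {0..T}" "t \<in> {0..T}" for s t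
    proof -
      have "\<bar>s / T - t / T\<bar> = \<bar>s - t\<bar> / T"
        using \<open>0 < T\<close> by (simp add: diff_divide_distrib[symmetric])
      then show ?thesis
        using holder_boundD[OF C, of "s / T" "t / T"] that \<open>0 < T\<close> by (simp add: powr_divide)
    qed
    then show ?case
      unfolding holder_on_def by (intro exI[of _ "C / T powr \<gamma>"]) auto
  qed
qed

section \<open>Bounds on the vector fields\<close>

lemma C_b1_imp_bounded_lipschitz:
  assumes "C_b1 f"
  shows "\<exists>A L. (\<forall>v. norm (f v) \<le> A) \<and> 0 \<le> L \<and> (\<forall>u v. norm (f u - f v) \<le> L * norm (u - v))"
proof -
  obtain f' where deriv: "\<And>x. (f has_derivative blinfun_apply (f' x)) (at x)" and "bounded (range f')"
    using assms unfolding C_b1_def by blast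
  then obtain L where L: "\<And>x. norm (f' x) \<le> L"
    unfolding bounded_iff by auto
  have "norm (f u - f v) \<le> L * norm (u - v)" for u v
    by (rule differentiable_bound[of UNIV f "\<lambda>x. blinfun_apply (f' x)"])
       (use deriv L in \<open>auto simp: norm_blinfun.rep_eq[symmetric]\<close>)
  moreover have "0 \<le> L"
    using order_trans[OF norm_ge_zero L] .
  moreover obtain A where "\<And>v. norm (f v) \<le> A"
    using assms unfolding C_b1_def bounded_iff by auto
  ultimately show ?thesis
    by blast
qed

lemma C_b1_imp_continuous_on:
  assumes "C_b1 f"
  shows "continuous_on UNIV f"
proof -
  obtain f' where "\<And>x. (f has_derivative blinfun_apply (f' x)) (at x)"
    using assms unfolding C_b1_def by blast
  then show ?thesis
    by (intro continuous_at_imp_continuous_on ballI has_derivative_continuous)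
qed

lemma C_b2_imp_C_b1:
  fixes f :: "'a::real_normed_vector \<Rightarrow> 'b::real_normed_vector"
  assumes "C_b2 f"
  shows "C_b1 f"
proof -
  obtain f' :: "'a \<Rightarrow> 'a \<Rightarrow>\<^sub>L 'b" where f: "bounded (range f)"
    and deriv: "\<forall>x. (f has_derivative blinfun_apply (f' x)) (at x)" and f': "C_b1 f'"
    using assms unfolding C_b2_def by blast
  have "bounded (range f')"
    using f' by (simp add: C_b1_def)
  then show ?thesis
    unfolding C_b1_def using f deriv C_b1_imp_continuous_on[OF f'] by (intro conjI exI[of _ f'])
qed

section \<open>Substituting a random parameter\<close>

text \<open>
  The processes \<open>X y\<close> are controlled for \<open>y > 0\<close> only, so the value \<open>0\<close> of \<open>Y\<close> has to be excluded. It
  has probability \<open>0\<close> because the law has a density, or is concentrated at \<open>1\<close>.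
\<close>

lemma M_Wright_rv_pos:
  assumes "prob_space M" and Y: "M_Wright_rv M \<beta> Y"
  shows "AE \<omega> in M. 0 < Y \<omega>"
proof -
  have nonneg: "AE \<omega> in M. 0 \<le> Y \<omega>"
    using Y by (simp add: M_Wright_rv_def)
  have "AE \<omega> in M. Y \<omega> \<noteq> 0"
  proof (cases "\<beta> = 1")
    case True
    then have "AE \<omega> in M. Y \<omega> = 1"
      using Y by (simp add: M_Wright_rv_def)
    then show ?thesis
      by eventually_elim simp
  next
    case False
    then obtain m where D: "distributed M lborel Y (\<lambda>\<tau>. ennreal (m \<tau>))"
      using Y unfolding M_Wright_rv_def by auto
    have "AE \<tau> in lborel. \<tau> \<noteq> (0::real)"
      by (rule AE_lborel_singleton)
    then have "AE \<tau> in lborel. 0 < ennreal (m \<tau>) \<longrightarrow> \<tau> \<noteq> 0"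
      by eventually_elim simp
    moreover have "Measurable.pred lborel (\<lambda>\<tau>::real. \<tau> \<noteq> 0)"
      by measurable
    ultimately show ?thesis
      using prob_space.distributed_AE2[OF \<open>prob_space M\<close> D, of "\<lambda>\<tau>. \<tau> \<noteq> 0"] by blast
  qed
  with nonneg show ?thesis
    by eventually_elim simp
qed

text \<open>
  The upper end of the \<open>i\<close>-th cell of the dyadic grid of level \<open>k\<close>. Taking the upper end keeps the
  approximations of a non-negative number strictly positive.
\<close>

definition dyadic_above :: "nat \<Rightarrow> nat \<Rightarrow> real" where
  "dyadic_above k i = (real i + 1) / 2 ^ k"

lemma dyadic_above_pos [simp]: "0 < dyadic_above k i"
  by (simp add: dyadic_above_def)

lemma dyadic_above_tendsto:
  assumes "0 \<le> y"
  shows "(\<lambda>k. dyadic_above k (nat \<lfloor>y * 2 ^ k\<rfloor>)) \<longlonglongrightarrow> y"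
proof (rule tendsto_sandwich)
  have bounds: "y \<le> dyadic_above k (nat \<lfloor>y * 2 ^ k\<rfloor>)" "dyadic_above k (nat \<lfloor>y * 2 ^ k\<rfloor>) \<le> y + 1 / 2 ^ k" for k
  proof -
    have fl: "real (nat \<lfloor>y * 2 ^ k\<rfloor>) = of_int \<lfloor>y * 2 ^ k\<rfloor>"
      using assms by simp
    have "y * 2 ^ k \<le> of_int \<lfloor>y * 2 ^ k\<rfloor> + 1"
      by linarith
    then show "y \<le> dyadic_above k (nat \<lfloor>y * 2 ^ k\<rfloor>)"
      unfolding dyadic_above_def fl by (simp add: pos_le_divide_eq)
    have "of_int \<lfloor>y * 2 ^ k\<rfloor> + 1 \<le> y * 2 ^ k + 1"
      by linarith
    then show "dyadic_above k (nat \<lfloor>y * 2 ^ k\<rfloor>) \<le> y + 1 / 2 ^ k"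
      unfolding dyadic_above_def fl by (simp add: pos_divide_le_eq distrib_right)
  qed
  show "\<forall>\<^sub>F k in sequentially. y \<le> dyadic_above k (nat \<lfloor>y * 2 ^ k\<rfloor>)"
    and "\<forall>\<^sub>F k in sequentially. dyadic_above k (nat \<lfloor>y * 2 ^ k\<rfloor>) \<le> y + 1 / 2 ^ k"
    by (simp_all add: bounds)
  have "(\<lambda>k. y + (1 / 2) ^ k) \<longlonglongrightarrow> y + 0"
    by (intro tendsto_intros LIMSEQ_realpow_zero) auto
  then show "(\<lambda>k. y + 1 / 2 ^ k) \<longlonglongrightarrow> y"
    by (simp add: power_one_over)
qed simp

text \<open>
  Redefining everything by a constant on a measurable null set makes the convergence hold everywhere.
  The values of the limit on that null set do not disturb its measurability, as the completion
  contains all subsets of null sets.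
\<close>

lemma borel_measurable_completion_AE_limit:
  fixes f :: "nat \<Rightarrow> 'w \<Rightarrow> 'b::metric_space"
  assumes f: "\<And>n. f n \<in> borel_measurable (completion M)"
    and lim: "AE \<omega> in M. (\<lambda>n. f n \<omega>) \<longlonglongrightarrow> g \<omega>"
  shows "g \<in> borel_measurable (completion M)"
proof -
  obtain N where N: "N \<in> null_sets M" and lim_N: "\<And>\<omega>. \<omega> \<in> space M \<Longrightarrow> \<omega> \<notin> N \<Longrightarrow> (\<lambda>n. f n \<omega>) \<longlonglongrightarrow> g \<omega>"
    using lim unfolding eventually_ae_filter by blast
  have N_sets: "N \<in> sets (completion M)"
    using N by auto
  define g' where "g' \<omega> = (if \<omega> \<in> N then undefined else g \<omega>)" for \<omega>
  have g': "g' \<in> borel_measurable (completion M)"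
  proof (rule borel_measurable_LIMSEQ_metric)
    show "(\<lambda>\<omega>. if \<omega> \<in> N then undefined else f n \<omega>) \<in> borel_measurable (completion M)" for n
      using N_sets f by (intro measurable_If_set) (auto intro: sets.Int)
    show "(\<lambda>n. if \<omega> \<in> N then undefined else f n \<omega>) \<longlonglongrightarrow> g' \<omega>" if "\<omega> \<in> space (completion M)" for \<omega>
      using lim_N that by (auto simp: g'_def)
  qed
  show ?thesis
  proof (rule measurableI)
    fix S :: "'b set" assume "S \<in> sets borel"
    then have "g' -` S \<inter> space (completion M) - N \<in> sets (completion M)"
      using measurable_sets[OF g'] N_sets by blast
    moreover have "g -` S \<inter> space M \<inter> N \<in> sets (completion M)"
      using N null_sets_completion_iff2[of "g -` S \<inter> space M \<inter> N" M] by (blast intro: null_setsD2)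
    moreover have "g -` S \<inter> space (completion M) =
        (g' -` S \<inter> space (completion M) - N) \<union> (g -` S \<inter> space M \<inter> N)"
      by (auto simp: g'_def)
    ultimately show "g -` S \<inter> space (completion M) \<in> sets (completion M)"
      by (metis sets.Un)
  qed simp
qed

text \<open>
  Rounding \<open>Y\<close> to a dyadic grid gives a parameter with countably many values, for which joint
  measurability of \<open>X\<close> is not an issue; continuity in the parameter removes the rounding.
\<close>

lemma borel_measurable_random_parameter:
  fixes X :: "real \<Rightarrow> 'w \<Rightarrow> 'b::metric_space"
  assumes X: "\<And>y. 0 < y \<Longrightarrow> X y \<in> borel_measurable (completion M)"
    and Y: "Y \<in> borel_measurable M" "AE \<omega> in M. 0 < Y \<omega>"
    and cont: "AE \<omega> in M. continuous_on {0<..} (\<lambda>y. X y \<omega>)"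
  shows "(\<lambda>\<omega>. X (Y \<omega>) \<omega>) \<in> borel_measurable (completion M)"
proof (rule borel_measurable_completion_AE_limit)
  show "(\<lambda>\<omega>. X (dyadic_above k (nat \<lfloor>Y \<omega> * 2 ^ k\<rfloor>)) \<omega>) \<in> borel_measurable (completion M)" for k
  proof (rule measurable_compose_countable[where f = "\<lambda>i. X (dyadic_above k i)"])
    have "(\<lambda>\<omega>. nat \<lfloor>Y \<omega> * 2 ^ k\<rfloor>) \<in> measurable M (count_space UNIV)"
      using Y(1) by measurable
    then show "(\<lambda>\<omega>. nat \<lfloor>Y \<omega> * 2 ^ k\<rfloor>) \<in> measurable (completion M) (count_space UNIV)"
      by (rule measurable_completion)
  qed (simp add: X)
  show "AE \<omega> in M. (\<lambda>k. X (dyadic_above k (nat \<lfloor>Y \<omega> * 2 ^ k\<rfloor>)) \<omega>) \<longlonglongrightarrow> X (Y \<omega>) \<omega>"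
    using Y(2) cont
  proof eventually_elim
    case (elim \<omega>)
    then show ?case
      by (intro continuous_on_tendsto_compose[OF elim(2) dyadic_above_tendsto]) auto
  qed
qed

theorem theorem6:
  fixes M :: "'w measure"
    and B :: "real \<Rightarrow> 'w \<Rightarrow> real ^ 'd"
    and Y :: "'w \<Rightarrow> real"
    and X :: "real \<Rightarrow> real \<Rightarrow> 'w \<Rightarrow> real ^ 'n"
    and x0 :: "real ^ 'n"
    and V0 :: "real ^ 'n \<Rightarrow> real ^ 'n"
    and V :: "'d \<Rightarrow> real ^ 'n \<Rightarrow> real ^ 'n"
    and T H \<beta> lam :: real
  assumes "prob_space M"
    and "0 < T" and "1/2 < H" and "H < 1" and "0 < \<beta>" and "\<beta> \<le> 1"
    and "1 - H < lam" and "lam < 1/2"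
    and "standard_fBm M H B"
    and "M_Wright_rv M \<beta> Y"
    and "indep_rv M borel Y
           (Pi\<^sub>M {0..} (\<lambda>_. borel)) (\<lambda>\<omega>. \<lambda>t\<in>{0::real..}. B t \<omega>)"
    and "C_b1 V0"
    and "\<And>j. C_b2 (V j)"
    and "\<And>y. 0 < y \<Longrightarrow> solves_SDE M T lam x0 (sqrt y) V0 V B (X y)"
    and "AE \<omega> in M. \<forall>t\<in>{0..T}. continuous_on {0<..} (\<lambda>y. X y t \<omega>)"
  shows "solves_SDE M T lam x0 1 V0 V
           (\<lambda>t \<omega>. sqrt (Y \<omega>) *\<^sub>R B t \<omega>) (\<lambda>t \<omega>. X (Y \<omega>) t \<omega>)"
proof -
  note sol = \<open>\<And>y. 0 < y \<Longrightarrow> solves_SDE M T lam x0 (sqrt y) V0 V B (X y)\<close>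
  note X_cont = \<open>AE \<omega> in M. \<forall>t\<in>{0..T}. continuous_on {0<..} (\<lambda>y. X y t \<omega>)\<close>
  have Y_meas: "Y \<in> borel_measurable M"
    using \<open>M_Wright_rv M \<beta> Y\<close> by (simp add: M_Wright_rv_def)
  note Y_pos = M_Wright_rv_pos[OF \<open>prob_space M\<close> \<open>M_Wright_rv M \<beta> Y\<close>]
  have exponent: "1 / 2 < 1 - lam" "1 - lam < 1" "1 - lam < H"
    using assms by auto
  obtain A0 where A0: "\<And>v. norm (V0 v) \<le> A0"
    using C_b1_imp_bounded_lipschitz[OF \<open>C_b1 V0\<close>] by blast
  have "\<forall>j. \<exists>A L. (\<forall>v. norm (V j v) \<le> A) \<and> 0 \<le> L \<and> (\<forall>u v. norm (V j u - V j v) \<le> L * norm (u - v))"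
    using C_b1_imp_bounded_lipschitz[OF C_b2_imp_C_b1[OF \<open>\<And>j. C_b2 (V j)\<close>]] by blast
  then obtain Aj Lj where "\<forall>j. (\<forall>v. norm (V j v) \<le> Aj j) \<and> 0 \<le> Lj j \<and>
      (\<forall>u v. norm (V j u - V j v) \<le> Lj j * norm (u - v))"
    by metis
  then have Aj: "\<And>j v. norm (V j v) \<le> Aj j" and Lj_nonneg: "\<And>j. 0 \<le> Lj j"
    and Lj: "\<And>j u v. norm (V j u - V j v) \<le> Lj j * norm (u - v)"
    by blast+
  define A where "A = A0 + (\<Sum>j\<in>UNIV. Aj j)"
  define L where "L = (\<Sum>j\<in>UNIV. Lj j)"
  have nonneg: "0 \<le> A0" "0 \<le> Aj j" for j
    using order_trans[OF norm_ge_zero A0] order_trans[OF norm_ge_zero Aj] by blast+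
  have A_V0: "norm (V0 v) \<le> A" for v
    unfolding A_def using nonneg by (intro add_increasing2 A0 sum_nonneg)
  have A_V: "norm (V j v) \<le> A" for j v
  proof -
    have "Aj j \<le> (\<Sum>j\<in>UNIV. Aj j)"
      using nonneg by (intro member_le_sum) auto
    with Aj[of j v] nonneg(1) show ?thesis
      unfolding A_def by linarith
  qed
  have L: "norm (V j u - V j v) \<le> L * norm (u - v)" for j u v
  proof -
    have "Lj j \<le> L"
      unfolding L_def using Lj_nonneg by (intro member_le_sum) auto
    with Lj[of j u v] show ?thesis
      by (meson mult_right_mono norm_ge_zero order_trans)
  qed
  have "0 \<le> L"
    unfolding L_def using Lj_nonneg by (intro sum_nonneg) auto
  have B_holder: "AE \<omega> in M. \<forall>j. holder_on (1 - lam) {0..T} (\<lambda>t. B t \<omega> $ j)"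
    using \<open>standard_fBm M H B\<close> exponent \<open>0 < T\<close>
    by (subst AE_all_countable) (auto simp: standard_fBm_def intro!: fBm_holder_paths[OF \<open>prob_space M\<close>])
  have dyadic_sol: "AE \<omega> in M. \<forall>k i. holder_on (1 - lam) {0..T} (\<lambda>t. X (dyadic_above k i) t \<omega>) \<and>
      path_equation T x0 (sqrt (dyadic_above k i)) V0 V (\<lambda>t. B t \<omega>) (\<lambda>t. X (dyadic_above k i) t \<omega>)"
    using sol[OF dyadic_above_pos] unfolding AE_all_countable solves_SDE_def by blast
  show ?thesis
    unfolding solves_SDE_def
  proof (intro conjI ballI)
    fix t assume t: "t \<in> {0..T}"
    show "(\<lambda>\<omega>. X (Y \<omega>) t \<omega>) \<in> borel_measurable (completion M)"
    proof (rule borel_measurable_random_parameter[where X = "\<lambda>y. X y t", OF _ Y_meas Y_pos])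
      show "X y t \<in> borel_measurable (completion M)" if "0 < y" for y
        using sol[OF that] t unfolding solves_SDE_def by blast
      show "AE \<omega> in M. continuous_on {0<..} (\<lambda>y. X y t \<omega>)"
        using X_cont by eventually_elim (use t in blast)
    qed
  next
    show "AE \<omega> in M. holder_on (1 - lam) {0..T} (\<lambda>t. X (Y \<omega>) t \<omega>) \<and>
        path_equation T x0 1 V0 V (\<lambda>t. sqrt (Y \<omega>) *\<^sub>R B t \<omega>) (\<lambda>t. X (Y \<omega>) t \<omega>)"
      using B_holder dyadic_sol X_cont Y_pos
    proof eventually_elim
      case (elim \<omega>)
      have "\<forall>j. \<exists>K\<ge>0. holder_bound K (1 - lam) {0..T} (\<lambda>t. B t \<omega> $ j)"
        using elim(1) by (simp add: holder_on_iff_holder_bound)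
      then obtain Kj where Kj: "\<And>j. 0 \<le> Kj j" "\<And>j. holder_bound (Kj j) (1 - lam) {0..T} (\<lambda>t. B t \<omega> $ j)"
        by metis
      define K where "K = (\<Sum>j\<in>UNIV. Kj j)"
      have "0 \<le> K"
        unfolding K_def using Kj(1) by (intro sum_nonneg) auto
      have K: "holder_bound K (1 - lam) {0..T} (\<lambda>t. B t \<omega> $ j)" for j
      proof -
        have "Kj j \<le> K"
          unfolding K_def using Kj(1) by (intro member_le_sum) auto
        then show ?thesis
          using Kj(2)[of j] unfolding holder_bound_def by (meson mult_right_mono order_trans powr_ge_zero)
      qed
      define y where "y k = dyadic_above k (nat \<lfloor>Y \<omega> * 2 ^ k\<rfloor>)" for k
      have y: "y \<longlonglongrightarrow> Y \<omega>"
        unfolding y_def using elim(4) by (intro dyadic_above_tendsto) simp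
      have "holder_on (1 - lam) {0..T} (\<lambda>t. X (Y \<omega>) t \<omega>) \<and>
          path_equation T x0 (sqrt (Y \<omega>)) V0 V (\<lambda>t. B t \<omega>) (\<lambda>t. X (Y \<omega>) t \<omega>)"
      proof (rule path_equation_limit[where x = "\<lambda>k t. X (y k) t \<omega>" and c = "\<lambda>k. sqrt (y k)",
            OF \<open>0 < T\<close> A_V0 A_V L \<open>0 \<le> L\<close> C_b1_imp_continuous_on[OF \<open>C_b1 V0\<close>] K \<open>0 \<le> K\<close> exponent(1,2)])
        show "(\<lambda>k. sqrt (y k)) \<longlonglongrightarrow> sqrt (Y \<omega>)"
          by (intro tendsto_intros y)
        show "(\<lambda>k. X (y k) t \<omega>) \<longlonglongrightarrow> X (Y \<omega>) t \<omega>" if "t \<in> {0..T}" for t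
          using elim(3,4) that
          by (intro continuous_on_tendsto_compose[OF _ y, of "{0<..}" "\<lambda>y. X y t \<omega>"]) (auto simp: y_def)
      qed (use elim(2) in \<open>auto simp: y_def\<close>)
      then show ?case
        by (intro conjI path_equation_scale_driver) simp_all
    qed
  qed
qed

end
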